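(* Let $1<p<\infty$, $0<\alpha<1/p$, and set $q=\frac{p}{1-\alpha p}$. Let $\theta_1$ and $\theta_2$ be positive numbers, and let $T_\alpha$ be any one of the operators $I_\alpha$, $R_\alpha$, $W_\alpha$. Then: (i) If $\theta_2<(1+\alpha q)\theta_1$, then $T_\alpha$ is not bounded from $L^{p),\theta_1}([0,1])$ to $L^{q),\theta_2}([0,1])$. (ii) If $\theta_2\ge(1+\alpha q)\theta_1$, then $T_\alpha$ is bounded from $L^{p),\theta_1}([0,1])$ to $L^{q),\theta_2}([0,1])$.
   Context: The potential operators are $(I_\alpha f)(x)=\int_0^1\frac{f(y)}{|x-y|^{1-\alpha}}\,dy$, $(R_\alpha f)(x)=\int_0^x\frac{f(t)}{(x-t)^{1-\alpha}}\,dt$, and $(W_\alpha f)(x)=\int_x^1\frac{f(t)}{(t-x)^{1-\alpha}}\,dt$, for $x\in(0,1)$. For $1<r<\infty$ and $\theta>0$, the generalized grand Lebesgue space $L^{r),\theta}([0,1])$ is the class of measurable $f:[0,1]\to\mathbb{R}$ for which the norm $\|f\|_{L^{r),\theta}([0,1])}=\sup_{0<\varepsilon<r-1}\left(\varepsilon^{\theta}\int_0^1|f(t)|^{r-\varepsilon}\,dt\right)^{1/(r-\varepsilon)}$ is finite. An operator $T$ is bounded from $L^{p),\theta_1}([0,1])$ to $L^{q),\theta_2}([0,1])$ if there is a constant $c>0$ with $\|Tf\|_{L^{q),\theta_2}([0,1])}\le c\|f\|_{L^{p),\theta_1}([0,1])}$ for all $f\in L^{p),\theta_1}([0,1])$.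 *)

theory Defs
  imports "HOL-Analysis.Analysis"
begin

text \<open>
  A function on \<open>[0,1]\<close> is represented by a function \<open>real \<Rightarrow> real\<close>; its values outside
  \<open>[0,1]\<close> are irrelevant, also for \<open>I_op\<close>, \<open>R_op\<close>, \<open>W_op\<close> evaluated at points of \<open>[0,1]\<close>. Measure and integral are Lebesgue's.

  For \<open>f\<close> integrable on \<open>[0,1]\<close>, in particular for \<open>f\<close> in a grand Lebesgue space, the integrals
  defining the potential operators converge absolutely for almost every \<open>x\<close>. At the remaining
  \<open>x\<close> (a null set) the library integral takes the value 0. The kernels have the value 0 at the
  singularity since \<open>0 powr a = 0\<close> and \<open>c / 0 = 0\<close>; this is again a null set.
\<close>

definition I_op :: "real \<Rightarrow> (real \<Rightarrow> real) \<Rightarrow> real \<Rightarrow> real" where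
  "I_op \<alpha> f x = (LINT y:{0..1}|lebesgue. f y / \<bar>x - y\<bar> powr (1 - \<alpha>))"

definition R_op :: "real \<Rightarrow> (real \<Rightarrow> real) \<Rightarrow> real \<Rightarrow> real" where
  "R_op \<alpha> f x = (LINT t:{0..x}|lebesgue. f t / (x - t) powr (1 - \<alpha>))"

definition W_op :: "real \<Rightarrow> (real \<Rightarrow> real) \<Rightarrow> real \<Rightarrow> real" where
  "W_op \<alpha> f x = (LINT t:{x..1}|lebesgue. f t / (t - x) powr (1 - \<alpha>))"

text \<open>Real powers of extended nonnegative reals, for exponents \<open>s > 0\<close> only.\<close>

definition ennreal_powr :: "ennreal \<Rightarrow> real \<Rightarrow> ennreal" where
  "ennreal_powr x s = (if x = \<infinity> then \<infinity> else ennreal (enn2real x powr s))"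

definition grand_norm :: "real \<Rightarrow> real \<Rightarrow> (real \<Rightarrow> real) \<Rightarrow> ennreal" where
  "grand_norm r \<theta> f =
     (SUP \<epsilon>\<in>{0<..<r - 1}.
        ennreal_powr
          (ennreal (\<epsilon> powr \<theta>) * (\<integral>\<^sup>+ t\<in>{0..1}. ennreal (\<bar>f t\<bar> powr (r - \<epsilon>)) \<partial>lebesgue))
          (1 / (r - \<epsilon>)))"

definition grand_space :: "real \<Rightarrow> real \<Rightarrow> (real \<Rightarrow> real) set" where
  "grand_space r \<theta> =
     {f. f \<in> borel_measurable (lebesgue_on {0..1}) \<and> grand_norm r \<theta> f < \<infinity>}"

text \<open>
  Membership of \<open>T f\<close> in the target space is stated besides the norm inequality because
  \<^const>\<open>nn_integral\<close> is total: the inequality alone does not express that \<open>T f\<close> is measurable.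
\<close>

definition grand_bounded ::
  "((real \<Rightarrow> real) \<Rightarrow> (real \<Rightarrow> real)) \<Rightarrow> real \<Rightarrow> real \<Rightarrow> real \<Rightarrow> real \<Rightarrow> bool" where
  "grand_bounded T p \<theta>\<^sub>1 q \<theta>\<^sub>2 \<longleftrightarrow>
     (\<exists>c>0. \<forall>f\<in>grand_space p \<theta>\<^sub>1.
        T f \<in> grand_space q \<theta>\<^sub>2 \<and>
        grand_norm q \<theta>\<^sub>2 (T f) \<le> ennreal c * grand_norm p \<theta>\<^sub>1 f)"

end

theory Submission
  imports Defs
begin

text \<open>
  The number \<open>1 + \<alpha> q\<close> equals \<open>q / p\<close>. A bound \<open>M\<close> on the norm of \<open>f\<close> in the source space means that the
  \<open>L\<^sup>s\<close> norm of \<open>f\<close> for \<open>s = p - \<epsilon>\<close> grows at most like \<open>M * \<epsilon> powr (- (\<theta>\<^sub>1 / s))\<close>. The potential operators map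
  \<open>L\<^sup>s\<close> to \<open>L\<^sup>r\<close> for \<open>1 / r = 1 / s - \<alpha>\<close>, with a constant that stays bounded as \<open>s\<close> tends to \<open>p\<close>. Writing
  \<open>r = q - \<eta>\<close>, the numbers \<open>\<epsilon>\<close> and \<open>\<eta>\<close> are comparable, so the \<open>L\<^sup>r\<close> norm of the image grows at most like
  \<open>\<eta> powr (- (\<theta>\<^sub>1 / s))\<close>, whereas the target space admits \<open>\<eta> powr (- (\<theta>\<^sub>2 / r))\<close>. This is enough if
  \<open>\<theta>\<^sub>2 \<ge> (q / p) * \<theta>\<^sub>1\<close>, see \<open>grand_norm_kernel_op_le\<close>.

  The uniform bound is the Hardy--Littlewood--Sobolev inequality with explicit constants,
  \<open>hardy_littlewood_sobolev\<close>. Its proof is elementary: at each level the potential is split according to the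
  distance and to the size of \<open>f\<close>, with cut-offs that depend on the level, and the resulting measure estimates
  are integrated over all levels.

  For smaller \<open>\<theta>\<^sub>2\<close> the indicators of \<open>{0..a}\<close> are counterexamples as \<open>a\<close> tends to \<open>0\<close>. With
  \<open>a = exp (- 1 / \<eta>)\<close>, the source norm is at most a constant times \<open>a powr (1 / p) * \<eta> powr (\<theta>\<^sub>1 / p)\<close>, while the
  image is at least \<open>a powr \<alpha> / 2\<close> on a set of measure \<open>a / 2\<close>, and so has a target norm of at least a
  constant times \<open>a powr (\<alpha> + 1 / q) * \<eta> powr (\<theta>\<^sub>2 / q)\<close>. As \<open>\<alpha> + 1 / q = 1 / p\<close>, boundedness
  would force \<open>\<theta>\<^sub>2 / q \<ge> \<theta>\<^sub>1 / p\<close>.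

  All three operators are restrictions \<open>kernel_op S \<alpha>\<close> of one Riesz potential to a set \<open>S\<close> in the plane. The
  upper bound holds for every Borel set \<open>S\<close>; the lower one uses that \<open>S\<close> contains a quarter of every
  square \<open>{0..a} \<times> {0..a}\<close>, cut at the midpoints.
\<close>

section \<open>Integrals of the kernel\<close>

lemma nn_integral_powr_from_0:
  fixes a x :: real
  assumes "0 < a" "0 \<le> x"
  shows "(\<integral>\<^sup>+t. ennreal (t powr (a - 1)) * indicator {0<..<x} t \<partial>lborel) = ennreal (x powr a / a)"
proof -
  have "(\<integral>\<^sup>+t. ennreal (t powr (a - 1)) * indicator {0..x} t \<partial>lborel) = ennreal (x powr a / a)"
    using has_integral_powr_from_0[of "a - 1" x] assms
    by (intro nn_integral_has_integral_lebesgue') auto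
  moreover have "AE t in lborel. t \<noteq> x"
    by (rule AE_lborel_singleton)
  then have "AE t in lborel. ennreal (t powr (a - 1)) * indicator {0<..<x} t
      = ennreal (t powr (a - 1)) * indicator {0..x} t"
    by eventually_elim (auto split: split_indicator)
  ultimately show ?thesis
    by (simp cong: nn_integral_cong_AE)
qed

lemma nn_integral_powr_to_infinity:
  fixes b \<delta> :: real
  assumes "0 < b" "0 < \<delta>"
  shows "(\<integral>\<^sup>+t. ennreal (t powr (- b - 1)) * indicator {\<delta>..} t \<partial>lborel) = ennreal (\<delta> powr (- b) / b)"
  using has_integral_powr_to_inf[of "- b - 1" \<delta>] assms
  by (intro nn_integral_has_integral_lebesgue') auto

text \<open>
  Integrals over \<open>\<real>\<close> of functions of \<open>\<bar>x - y\<bar>\<close> reduce to the half line, so that both the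
  singular part and the tail of the kernel are computed from the two power integrals above.
\<close>

lemma nn_integral_radial:
  fixes h :: "real \<Rightarrow> ennreal"
  assumes [measurable]: "h \<in> borel_measurable borel"
  shows "(\<integral>\<^sup>+y. h \<bar>x - y\<bar> \<partial>lborel) = 2 * (\<integral>\<^sup>+t. h t * indicator {0<..} t \<partial>lborel)"
proof -
  have "(\<integral>\<^sup>+y. h \<bar>x - y\<bar> \<partial>lborel) = (\<integral>\<^sup>+u. h \<bar>u\<bar> \<partial>lborel)"
    by (subst (2) nn_integral_real_affine[where c = "-1" and t = x]) auto
  also have "\<dots> = (\<integral>\<^sup>+u. h u * indicator {0<..} u + h (- u) * indicator {0<..} (- u) \<partial>lborel)"
  proof (rule nn_integral_cong_AE)
    have "AE u in lborel. u \<noteq> (0::real)"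
      by (rule AE_lborel_singleton)
    then show "AE u in lborel. h \<bar>u\<bar> = h u * indicator {0<..} u + h (- u) * indicator {0<..} (- u)"
      by eventually_elim (auto split: split_indicator)
  qed
  also have "\<dots> = (\<integral>\<^sup>+u. h u * indicator {0<..} u \<partial>lborel)
      + (\<integral>\<^sup>+u. h (- u) * indicator {0<..} (- u) \<partial>lborel)"
    by (rule nn_integral_add) auto
  also have "(\<integral>\<^sup>+u. h (- u) * indicator {0<..} (- u) \<partial>lborel)
      = (\<integral>\<^sup>+u. h u * indicator {0<..} u \<partial>lborel)"
    by (subst (2) nn_integral_real_affine[where c = "-1" and t = 0]) auto
  finally show ?thesis
    by (simp add: mult_2)
qed

lemma near_kernel_mass:
  fixes \<alpha> \<delta> :: real
  assumes "0 < \<alpha>" "0 \<le> \<delta>"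
  shows "(\<integral>\<^sup>+y. ennreal (\<bar>x - y\<bar> powr (\<alpha> - 1)) * indicator {..<\<delta>} \<bar>x - y\<bar> \<partial>lborel)
    = ennreal (2 / \<alpha> * \<delta> powr \<alpha>)"
proof -
  have "(\<integral>\<^sup>+y. ennreal (\<bar>x - y\<bar> powr (\<alpha> - 1)) * indicator {..<\<delta>} \<bar>x - y\<bar> \<partial>lborel)
    = 2 * (\<integral>\<^sup>+t. ennreal (t powr (\<alpha> - 1)) * indicator {..<\<delta>} t * indicator {0<..} t \<partial>lborel)"
    by (rule nn_integral_radial) measurable
  also have "\<dots> = 2 * (\<integral>\<^sup>+t. ennreal (t powr (\<alpha> - 1)) * indicator {0<..<\<delta>} t \<partial>lborel)"
    by (rule arg_cong[where f = "\<lambda>z. 2 * z"], intro nn_integral_cong) (auto split: split_indicator)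
  also have "\<dots> = ennreal (2 * (\<delta> powr \<alpha> / \<alpha>))"
    using assms by (subst nn_integral_powr_from_0) (simp_all add: ennreal_mult' del: times_divide_eq_right)
  finally show ?thesis
    by (simp add: mult.commute)
qed

section \<open>The Hardy--Littlewood--Sobolev inequality with explicit constants\<close>

lemma Young_weak:
  fixes a b s :: real
  assumes "0 \<le> a" "0 \<le> b" "1 < s"
  shows "a * b \<le> a powr s + b powr (s / (s - 1))"
proof -
  have 1: "1 / s + 1 / (s / (s - 1)) = 1"
    using assms by (simp add: field_simps)
  have "a * b \<le> a powr s / s + b powr (s / (s - 1)) / (s / (s - 1))"
    using assms by (intro Youngs_inequality 1) (auto simp: field_simps)
  also have "\<dots> \<le> a powr s + b powr (s / (s - 1))"
    using assms mult_left_mono[of 1 s "a powr s"] mult_left_mono[of "s - 1" s "b powr (s / (s - 1))"]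
    by (intro add_mono) (simp_all add: field_simps)
  finally show ?thesis .
qed

text \<open>
  Hoelder's inequality with exponents \<open>s\<close> and \<open>s' = s / (s - 1)\<close> applies: the tail of the kernel lies in
  \<open>L\<^sup>s\<^sup>'\<close> because \<open>\<alpha> s < 1\<close>. Since \<open>f\<close> is normalised, it suffices to apply Young's inequality pointwise after
  scaling the kernel by \<open>\<delta> powr (1 / s - \<alpha>)\<close>, which makes its \<open>L\<^sup>s\<^sup>'\<close> norm beyond \<open>\<delta>\<close> independent of \<open>\<delta>\<close>.
\<close>

lemma far_potential_bound:
  fixes f :: "real \<Rightarrow> real" and \<alpha> s \<delta> :: real
  assumes [measurable]: "f \<in> borel_measurable borel" and f0: "\<And>y. 0 \<le> f y"
    and s: "1 < s" "\<alpha> * s < 1" and \<delta>: "0 < \<delta>"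
    and norm: "(\<integral>\<^sup>+y. ennreal (f y powr s) \<partial>lborel) \<le> 1"
  shows "(\<integral>\<^sup>+y. ennreal (f y * \<bar>x - y\<bar> powr (\<alpha> - 1)) * indicator {\<delta>..} \<bar>x - y\<bar> \<partial>lborel)
    \<le> ennreal ((1 + 2 * (s - 1) / (1 - \<alpha> * s)) * \<delta> powr (\<alpha> - 1 / s))"
proof -
  define b where "b = (1 - \<alpha> * s) / (s - 1)"
  have b: "0 < b"
    using s by (simp add: b_def)
  define k where "k = (\<lambda>t::real. t powr (- b - 1))"
  have e1: "(\<alpha> - 1) * (s / (s - 1)) = - b - 1" and e2: "(1 / s - \<alpha>) * (s / (s - 1)) = b"
    using s by (simp_all add: b_def field_simps)
  have pt: "f y * \<bar>x - y\<bar> powr (\<alpha> - 1)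
      \<le> \<delta> powr (\<alpha> - 1 / s) * (f y powr s + \<delta> powr b * k \<bar>x - y\<bar>)" for y
  proof -
    have "f y * (\<bar>x - y\<bar> powr (\<alpha> - 1) * \<delta> powr (1 / s - \<alpha>))
      \<le> f y powr s + (\<bar>x - y\<bar> powr (\<alpha> - 1) * \<delta> powr (1 / s - \<alpha>)) powr (s / (s - 1))"
      using s f0 by (intro Young_weak) auto
    also have "(\<bar>x - y\<bar> powr (\<alpha> - 1) * \<delta> powr (1 / s - \<alpha>)) powr (s / (s - 1))
      = \<delta> powr b * k \<bar>x - y\<bar>"
      by (simp only: powr_mult powr_powr e1 e2 k_def mult.commute)
    finally have "\<delta> powr (\<alpha> - 1 / s) * (f y * (\<bar>x - y\<bar> powr (\<alpha> - 1) * \<delta> powr (1 / s - \<alpha>)))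
      \<le> \<delta> powr (\<alpha> - 1 / s) * (f y powr s + \<delta> powr b * k \<bar>x - y\<bar>)"
      by (intro mult_left_mono) auto
    moreover have "\<delta> powr (\<alpha> - 1 / s) * \<delta> powr (1 / s - \<alpha>) = 1"
      using \<delta> by (simp add: powr_add[symmetric])
    moreover have "\<delta> powr (\<alpha> - 1 / s) * (f y * (\<bar>x - y\<bar> powr (\<alpha> - 1) * \<delta> powr (1 / s - \<alpha>)))
      = f y * \<bar>x - y\<bar> powr (\<alpha> - 1) * (\<delta> powr (\<alpha> - 1 / s) * \<delta> powr (1 / s - \<alpha>))"
      by (simp only: mult_ac)
    ultimately show ?thesis
      by simp
  qed
  have kint: "(\<integral>\<^sup>+y. ennreal (k \<bar>x - y\<bar>) * indicator {\<delta>..} \<bar>x - y\<bar> \<partial>lborel)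
      = ennreal (2 * (\<delta> powr (- b) / b))"
  proof -
    have "(\<integral>\<^sup>+y. ennreal (k \<bar>x - y\<bar>) * indicator {\<delta>..} \<bar>x - y\<bar> \<partial>lborel)
      = 2 * (\<integral>\<^sup>+t. ennreal (k t) * indicator {\<delta>..} t * indicator {0<..} t \<partial>lborel)"
      unfolding k_def by (rule nn_integral_radial) measurable
    also have "\<dots> = 2 * (\<integral>\<^sup>+t. ennreal (t powr (- b - 1)) * indicator {\<delta>..} t \<partial>lborel)"
      by (rule arg_cong[where f = "\<lambda>z. 2 * z"], intro nn_integral_cong)
        (use \<delta> in \<open>auto simp: k_def split: split_indicator\<close>)
    also have "\<dots> = ennreal (2 * (\<delta> powr (- b) / b))"
      using b \<delta> by (subst nn_integral_powr_to_infinity)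
        (simp_all add: ennreal_mult' del: times_divide_eq_right)
    finally show ?thesis .
  qed
  have "(\<integral>\<^sup>+y. ennreal (f y * \<bar>x - y\<bar> powr (\<alpha> - 1)) * indicator {\<delta>..} \<bar>x - y\<bar> \<partial>lborel)
    \<le> (\<integral>\<^sup>+y. ennreal (\<delta> powr (\<alpha> - 1 / s)) * (ennreal (f y powr s)
          + ennreal (\<delta> powr b) * (ennreal (k \<bar>x - y\<bar>) * indicator {\<delta>..} \<bar>x - y\<bar>)) \<partial>lborel)"
    by (intro nn_integral_mono)
      (auto simp: indicator_def k_def ennreal_mult'[symmetric] ennreal_plus[symmetric]
        simp del: ennreal_plus intro!: ennreal_leI order_trans[OF pt])
  also have "\<dots> = ennreal (\<delta> powr (\<alpha> - 1 / s)) * ((\<integral>\<^sup>+y. ennreal (f y powr s) \<partial>lborel)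
      + ennreal (\<delta> powr b) * ennreal (2 * (\<delta> powr (- b) / b)))"
    unfolding kint[symmetric] k_def by (simp add: nn_integral_cmult nn_integral_add)
  also have "\<dots> \<le> ennreal (\<delta> powr (\<alpha> - 1 / s)) * (1 + ennreal (\<delta> powr b) * ennreal (2 * (\<delta> powr (- b) / b)))"
    by (intro mult_left_mono add_mono norm) auto
  also have "\<dots> = ennreal (\<delta> powr (\<alpha> - 1 / s) * (1 + \<delta> powr b * (2 * (\<delta> powr (- b) / b))))"
    using b by (simp add: ennreal_mult' ennreal_plus ennreal_1[symmetric] del: ennreal_1 times_divide_eq_right)
  also have "\<delta> powr b * (2 * (\<delta> powr (- b) / b)) = 2 * (s - 1) / (1 - \<alpha> * s)"
  proof -
    have "\<delta> powr b * (2 * (\<delta> powr (- b) / b)) = (\<delta> powr b * \<delta> powr (- b)) * (2 / b)"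
      by simp
    also have "\<dots> = 2 * (s - 1) / (1 - \<alpha> * s)"
      using \<delta> by (simp add: powr_add[symmetric] b_def)
    finally show ?thesis .
  qed
  finally show ?thesis
    by (simp add: mult.commute)
qed

lemma near_small_potential_bound:
  fixes f :: "real \<Rightarrow> real" and \<alpha> S \<delta> :: real
  assumes "0 < \<alpha>" "0 \<le> \<delta>" "0 \<le> S"
    and [measurable]: "f \<in> borel_measurable borel"
  shows "(\<integral>\<^sup>+y. ennreal (f y * \<bar>x - y\<bar> powr (\<alpha> - 1)) * (indicator {..<\<delta>} \<bar>x - y\<bar> * indicator {..S} (f y)) \<partial>lborel)
    \<le> ennreal (2 / \<alpha> * S * \<delta> powr \<alpha>)"
proof -
  have "(\<integral>\<^sup>+y. ennreal (f y * \<bar>x - y\<bar> powr (\<alpha> - 1)) * (indicator {..<\<delta>} \<bar>x - y\<bar> * indicator {..S} (f y)) \<partial>lborel)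
    \<le> (\<integral>\<^sup>+y. ennreal S * (ennreal (\<bar>x - y\<bar> powr (\<alpha> - 1)) * indicator {..<\<delta>} \<bar>x - y\<bar>) \<partial>lborel)"
    using assms by (intro nn_integral_mono)
      (auto simp: indicator_def ennreal_mult'[symmetric] intro!: ennreal_leI mult_right_mono)
  also have "\<dots> = ennreal S * ennreal (2 / \<alpha> * \<delta> powr \<alpha>)"
    using assms by (simp add: nn_integral_cmult near_kernel_mass)
  also have "\<dots> = ennreal (2 / \<alpha> * S * \<delta> powr \<alpha>)"
    using assms by (simp add: ennreal_mult'[symmetric] mult_ac)
  finally show ?thesis .
qed

lemma pred_greaterThan [measurable]:
  fixes f g :: "'a \<Rightarrow> real"
  assumes [measurable]: "f \<in> borel_measurable M" "g \<in> borel_measurable M"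
  shows "Measurable.pred M (\<lambda>x. f x \<in> {g x<..})"
  unfolding greaterThan_iff by measurable

text \<open>
  At a level \<open>l\<close> the potential of \<open>f\<close> is split into the contribution of the points \<open>y\<close> at distance
  at least \<open>\<delta>\<close> from \<open>x\<close>, of the nearer points with \<open>f y \<le> S\<close>, and of the nearer points with \<open>f y > S\<close>.
  The radius \<open>\<delta>\<close> and the threshold \<open>S\<close> are chosen, depending on \<open>l\<close>, such that the first two
  contributions are at most \<open>l\<close> each. Where the potential exceeds \<open>3 l\<close> the third one therefore
  exceeds \<open>l\<close>, and Chebyshev's inequality bounds the measure of this set by \<open>1 / l\<close> times the mass
  of the near kernel times the integral of \<open>f\<close> over \<open>{f > S}\<close>. The potential enters through an arbitrary finite
  minorant \<open>F\<close>, as it may be infinite on a null set. Admitting every \<open>B\<close> above the tail constant will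
  give estimates that are uniform in \<open>s\<close>.
\<close>

lemma potential_superlevel_bound:
  fixes f F :: "real \<Rightarrow> real" and \<alpha> s r B D l :: real
  assumes [measurable]: "f \<in> borel_measurable borel" "F \<in> borel_measurable borel"
    and f0: "\<And>y. 0 \<le> f y"
    and s: "1 < s" "0 < \<alpha>" "\<alpha> * s < 1" and r: "r = s / (1 - \<alpha> * s)"
    and norm: "(\<integral>\<^sup>+y. ennreal (f y powr s) \<partial>lborel) \<le> 1"
    and F: "\<And>x. ennreal (F x) \<le> (\<integral>\<^sup>+y. ennreal (f y * \<bar>x - y\<bar> powr (\<alpha> - 1)) \<partial>lborel)"
    and B: "1 + 2 * (s - 1) / (1 - \<alpha> * s) \<le> B"
    and D: "D = \<alpha> / 2 * B powr (- (\<alpha> * r))"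
    and l: "0 < l"
  shows "emeasure lborel {x. 3 * l < F x} \<le> ennreal (l powr (- 1 - \<alpha> * r) / D) *
    (\<integral>\<^sup>+y. ennreal (f y) * indicator {D * l powr (1 + \<alpha> * r)<..} (f y) \<partial>lborel)"
proof -
  have "0 < 2 * (s - 1) / (1 - \<alpha> * s)"
    using s by simp
  then have B0: "0 < B"
    using B by linarith
  have r0: "0 < r"
    using s r by simp
  have er: "r * (\<alpha> - 1 / s) = - 1"
    using s r by (simp add: field_simps)
  \<comment> \<open>The radius solves \<open>B * \<delta> powr (\<alpha> - 1 / s) = l\<close> and the threshold
    solves \<open>2 / \<alpha> * S * \<delta> powr \<alpha> = l\<close>.\<close>
  define \<delta> where "\<delta> = (B / l) powr r"
  define S where "S = D * l powr (1 + \<alpha> * r)"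
  have pos: "0 < \<delta>" "0 < S" "0 < D"
    using B0 l s by (simp_all add: \<delta>_def S_def D)
  define K where "K = (\<lambda>x y::real. ennreal (f y * \<bar>x - y\<bar> powr (\<alpha> - 1)))"
  define V where "V = (\<lambda>x. \<integral>\<^sup>+y. K x y * (indicator {..<\<delta>} \<bar>x - y\<bar> * indicator {S<..} (f y)) \<partial>lborel)"
  have Kx [measurable]: "K x \<in> borel_measurable borel" for x
    unfolding K_def by measurable
  have far: "(\<integral>\<^sup>+y. K x y * indicator {\<delta>..} \<bar>x - y\<bar> \<partial>lborel) \<le> ennreal l" for x
  proof -
    have "(1 + 2 * (s - 1) / (1 - \<alpha> * s)) * \<delta> powr (\<alpha> - 1 / s) \<le> B * \<delta> powr (\<alpha> - 1 / s)"
      using B by (intro mult_right_mono) auto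
    also have "\<dots> = l"
      using B0 l by (simp add: \<delta>_def powr_powr er powr_minus)
    finally show ?thesis
      unfolding K_def using s
      by (intro order_trans[OF far_potential_bound[OF _ f0 _ _ pos(1) norm]] ennreal_leI) auto
  qed
  have small: "(\<integral>\<^sup>+y. K x y * (indicator {..<\<delta>} \<bar>x - y\<bar> * indicator {..S} (f y)) \<partial>lborel) \<le> ennreal l" for x
  proof -
    have "2 / \<alpha> * S * \<delta> powr \<alpha> = B powr (- (\<alpha> * r)) * B powr (\<alpha> * r) * (l powr (1 + \<alpha> * r) * l powr (- (\<alpha> * r)))"
      using B0 l s by (simp add: S_def D \<delta>_def powr_powr powr_divide powr_minus field_simps)
    also have "\<dots> = l"
      using B0 l by (simp add: powr_add[symmetric])
    finally have "ennreal (2 / \<alpha> * S * \<delta> powr \<alpha>) = ennreal l"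
      by simp
    then show ?thesis
      unfolding K_def using s pos near_small_potential_bound[of \<alpha> \<delta> S f x] by simp
  qed
  have pt: "indicator {x. 3 * l < F x} x \<le> ennreal (1 / l) * V x" for x
  proof (cases "3 * l < F x")
    case True
    have "ennreal (3 * l) \<le> ennreal (F x)"
      using True by (intro ennreal_leI) simp
    also have "\<dots> \<le> (\<integral>\<^sup>+y. K x y \<partial>lborel)"
      using F by (simp add: K_def)
    also have "\<dots> = (\<integral>\<^sup>+y. K x y * indicator {\<delta>..} \<bar>x - y\<bar>
        + (K x y * (indicator {..<\<delta>} \<bar>x - y\<bar> * indicator {..S} (f y))
        + K x y * (indicator {..<\<delta>} \<bar>x - y\<bar> * indicator {S<..} (f y))) \<partial>lborel)"
      by (intro nn_integral_cong) (auto split: split_indicator)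
    also have "\<dots> = (\<integral>\<^sup>+y. K x y * indicator {\<delta>..} \<bar>x - y\<bar> \<partial>lborel)
        + ((\<integral>\<^sup>+y. K x y * (indicator {..<\<delta>} \<bar>x - y\<bar> * indicator {..S} (f y)) \<partial>lborel) + V x)"
      unfolding V_def by (subst nn_integral_add, measurable, subst nn_integral_add, measurable)
    also have "\<dots> \<le> ennreal l + (ennreal l + V x)"
      by (intro add_mono far small order_refl)
    finally have "ennreal (2 * l) + ennreal l \<le> ennreal (2 * l) + V x"
      using l by (simp add: ennreal_plus[symmetric] add.assoc[symmetric] del: ennreal_plus)
    then have "ennreal l \<le> V x"
      by (simp add: ennreal_add_left_cancel_le)
    then have "ennreal (1 / l) * ennreal l \<le> ennreal (1 / l) * V x"
      by (intro mult_left_mono) auto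
    then show ?thesis
      using True l by (simp add: ennreal_mult'[symmetric])
  qed simp
  have "emeasure lborel {x. 3 * l < F x} = (\<integral>\<^sup>+x. indicator {x. 3 * l < F x} x \<partial>lborel)"
    by simp
  also have "\<dots> \<le> (\<integral>\<^sup>+x. ennreal (1 / l) * V x \<partial>lborel)"
    by (intro nn_integral_mono pt)
  also have "\<dots> = ennreal (1 / l) * (\<integral>\<^sup>+x. V x \<partial>lborel)"
    unfolding V_def K_def by (rule nn_integral_cmult) measurable
  also have "(\<integral>\<^sup>+x. V x \<partial>lborel)
    = (\<integral>\<^sup>+y. (\<integral>\<^sup>+x. K x y * (indicator {..<\<delta>} \<bar>x - y\<bar> * indicator {S<..} (f y)) \<partial>lborel) \<partial>lborel)"
    unfolding V_def K_def by (rule lborel_pair.Fubini') measurable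
  also have "\<dots> = (\<integral>\<^sup>+y. ennreal (2 / \<alpha> * \<delta> powr \<alpha>) * (ennreal (f y) * indicator {S<..} (f y)) \<partial>lborel)"
  proof (rule nn_integral_cong)
    fix y
    have "(\<integral>\<^sup>+x. K x y * (indicator {..<\<delta>} \<bar>x - y\<bar> * indicator {S<..} (f y)) \<partial>lborel)
      = (\<integral>\<^sup>+x. (ennreal (f y) * indicator {S<..} (f y)) *
          (ennreal (\<bar>y - x\<bar> powr (\<alpha> - 1)) * indicator {..<\<delta>} \<bar>y - x\<bar>) \<partial>lborel)"
      by (intro nn_integral_cong)
        (simp add: K_def ennreal_mult' f0 abs_minus_commute mult_ac)
    also have "\<dots> = (ennreal (f y) * indicator {S<..} (f y)) * ennreal (2 / \<alpha> * \<delta> powr \<alpha>)"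
      using s pos by (simp add: nn_integral_cmult near_kernel_mass)
    finally show "(\<integral>\<^sup>+x. K x y * (indicator {..<\<delta>} \<bar>x - y\<bar> * indicator {S<..} (f y)) \<partial>lborel)
      = ennreal (2 / \<alpha> * \<delta> powr \<alpha>) * (ennreal (f y) * indicator {S<..} (f y))"
      by (simp add: mult.commute)
  qed
  also have "\<dots> = ennreal (2 / \<alpha> * \<delta> powr \<alpha>) * (\<integral>\<^sup>+y. ennreal (f y) * indicator {S<..} (f y) \<partial>lborel)"
    by (rule nn_integral_cmult) measurable
  also have "ennreal (1 / l) * (ennreal (2 / \<alpha> * \<delta> powr \<alpha>) * (\<integral>\<^sup>+y. ennreal (f y) * indicator {S<..} (f y) \<partial>lborel))
    = ennreal (1 / l * (2 / \<alpha> * \<delta> powr \<alpha>)) * (\<integral>\<^sup>+y. ennreal (f y) * indicator {S<..} (f y) \<partial>lborel)"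
    using l s by (subst ennreal_mult) (auto simp: mult_ac)
  also have "1 / l * (2 / \<alpha> * \<delta> powr \<alpha>) = l powr (- 1 - \<alpha> * r) / D"
    using B0 l s by (simp add: D \<delta>_def powr_powr powr_divide powr_minus powr_diff field_simps)
  finally show ?thesis
    by (simp add: S_def)
qed

text \<open>
  The super-level estimate is inserted into the layer-cake formula for the integral of \<open>F powr r\<close>. After
  exchanging the integrals, the inner integral over the levels \<open>l\<close> with \<open>D * l powr (r / s) < f y\<close> is a
  power integral, convergent at \<open>0\<close> because \<open>s > 1\<close>, and equals a constant times \<open>f y powr (s - 1)\<close>;
  together with the factor \<open>f y\<close> this restores the integral of \<open>f powr s\<close>. This route avoids maximal
  functions and interpolation and shows how the constant depends on \<open>s\<close>.
\<close>

lemma hardy_littlewood_sobolev: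
  fixes f F :: "real \<Rightarrow> real" and \<alpha> s r B D :: real
  assumes [measurable]: "f \<in> borel_measurable borel" "F \<in> borel_measurable borel"
    and f0: "\<And>y. 0 \<le> f y" and F0: "\<And>x. 0 \<le> F x"
    and s: "1 < s" "0 < \<alpha>" "\<alpha> * s < 1" and r: "r = s / (1 - \<alpha> * s)"
    and norm: "(\<integral>\<^sup>+y. ennreal (f y powr s) \<partial>lborel) \<le> 1"
    and F: "\<And>x. ennreal (F x) \<le> (\<integral>\<^sup>+y. ennreal (f y * \<bar>x - y\<bar> powr (\<alpha> - 1)) \<partial>lborel)"
    and B: "1 + 2 * (s - 1) / (1 - \<alpha> * s) \<le> B"
    and D: "D = \<alpha> / 2 * B powr (- (\<alpha> * r))"
  shows "(\<integral>\<^sup>+x. ennreal (F x powr r) \<partial>lborel) \<le> ennreal (3 powr r * (s / (s - 1)) * D powr (- s))"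
proof -
  have "0 < 2 * (s - 1) / (1 - \<alpha> * s)"
    using s by simp
  then have B0: "0 < B"
    using B by linarith
  have D0: "0 < D"
    using B0 s by (simp add: D)
  have r0: "0 < r"
    using s r by simp
  \<comment> \<open>The threshold in \<open>f\<close> at level \<open>l\<close> is \<open>D * l powr e\<close>.\<close>
  define e where "e = 1 + \<alpha> * r"
  have e: "e = r / s"
    using s r by (simp add: e_def field_simps)
  have e0: "0 < e"
    using r0 s e by simp
  have ind: "indicator {0<..} l * indicator {3 * l<..} (F x) = (indicator {0<..<F x / 3} l :: ennreal)" for x l
    by (auto split: split_indicator)
  have layer: "ennreal (F x powr r)
      = ennreal (3 powr r * r) * (\<integral>\<^sup>+l. ennreal (l powr (r - 1)) * (indicator {0<..} l * indicator {3 * l<..} (F x)) \<partial>lborel)" for x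
    using r0 F0[of x] by (simp add: ind nn_integral_powr_from_0 ennreal_mult'[symmetric] powr_divide)
  have inner: "(\<integral>\<^sup>+l. ennreal (l powr (r - e - 1)) * (indicator {0<..} l * indicator {D * l powr e<..} (f y)) \<partial>lborel)
      = ennreal (f y powr (s - 1) * D powr (1 - s) / (e * (s - 1)))" for y
  proof -
    have iff: "D * l powr e < f y \<longleftrightarrow> l < (f y / D) powr (1 / e)" if "0 < l" for l
    proof -
      have "D * l powr e < f y \<longleftrightarrow> l powr e < f y / D"
        using D0 by (simp add: field_simps)
      also have "\<dots> \<longleftrightarrow> (l powr e) powr (1 / e) < (f y / D) powr (1 / e)"
        using e0 D0 f0[of y] powr_less_mono2[of "1 / e" "l powr e" "f y / D"]
          powr_mono2[of "1 / e" "f y / D" "l powr e"]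
        by (cases "l powr e < f y / D") (auto simp: not_less)
      finally show ?thesis
        using e0 that by (simp add: powr_powr)
    qed
    have ex: "r - e - 1 = e * (s - 1) - 1"
      using s by (simp add: e field_simps)
    have ee: "1 / e * (e * (s - 1)) = s - 1"
      using e0 by simp
    have "(\<integral>\<^sup>+l. ennreal (l powr (r - e - 1)) * (indicator {0<..} l * indicator {D * l powr e<..} (f y)) \<partial>lborel)
      = (\<integral>\<^sup>+l. ennreal (l powr (e * (s - 1) - 1)) * indicator {0<..<(f y / D) powr (1 / e)} l \<partial>lborel)"
      by (intro nn_integral_cong) (auto simp: iff ex split: split_indicator)
    also have "\<dots> = ennreal (((f y / D) powr (1 / e)) powr (e * (s - 1)) / (e * (s - 1)))"
      using e0 s by (intro nn_integral_powr_from_0) auto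
    also have "((f y / D) powr (1 / e)) powr (e * (s - 1)) = f y powr (s - 1) * D powr (1 - s)"
      unfolding powr_powr ee using D0 f0[of y]
      by (simp add: powr_divide powr_minus[of D "s - 1", simplified] field_simps)
    finally show ?thesis .
  qed
  have "(\<integral>\<^sup>+x. (\<integral>\<^sup>+l. ennreal (l powr (r - 1)) * (indicator {0<..} l * indicator {3 * l<..} (F x)) \<partial>lborel) \<partial>lborel)
    = (\<integral>\<^sup>+l. (\<integral>\<^sup>+x. ennreal (l powr (r - 1)) * (indicator {0<..} l * indicator {3 * l<..} (F x)) \<partial>lborel) \<partial>lborel)"
    by (rule lborel_pair.Fubini'[symmetric]) measurable
  also have "\<dots> \<le> (\<integral>\<^sup>+l. (\<integral>\<^sup>+y. ennreal (1 / D) * (ennreal (f y) *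
      (ennreal (l powr (r - e - 1)) * (indicator {0<..} l * indicator {D * l powr e<..} (f y)))) \<partial>lborel) \<partial>lborel)"
  proof (rule nn_integral_mono)
    fix l :: real
    show "(\<integral>\<^sup>+x. ennreal (l powr (r - 1)) * (indicator {0<..} l * indicator {3 * l<..} (F x)) \<partial>lborel)
      \<le> (\<integral>\<^sup>+y. ennreal (1 / D) * (ennreal (f y) *
      (ennreal (l powr (r - e - 1)) * (indicator {0<..} l * indicator {D * l powr e<..} (f y)))) \<partial>lborel)"
    proof (cases "0 < l")
      case True
      have "(\<integral>\<^sup>+x. ennreal (l powr (r - 1)) * (indicator {0<..} l * indicator {3 * l<..} (F x)) \<partial>lborel)
        = (\<integral>\<^sup>+x. ennreal (l powr (r - 1)) * indicator {x. 3 * l < F x} x \<partial>lborel)"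
        using True by (intro nn_integral_cong) (auto split: split_indicator)
      also have "\<dots> = ennreal (l powr (r - 1)) * emeasure lborel {x. 3 * l < F x}"
        by (rule nn_integral_cmult_indicator) measurable
      also have "\<dots> \<le> ennreal (l powr (r - 1)) * (ennreal (l powr (- 1 - \<alpha> * r) / D) *
          (\<integral>\<^sup>+y. ennreal (f y) * indicator {D * l powr (1 + \<alpha> * r)<..} (f y) \<partial>lborel))"
        using assms True
        by (intro mult_left_mono potential_superlevel_bound[where s = s and B = B]) auto
      also have "\<dots> = ennreal (l powr (r - 1) * (l powr (- e) / D)) *
          (\<integral>\<^sup>+y. ennreal (f y) * indicator {D * l powr e<..} (f y) \<partial>lborel)"
        by (simp add: ennreal_mult'[symmetric] mult.assoc[symmetric] e_def)
      also have "l powr (r - 1) * (l powr (- e) / D) = 1 / D * l powr (r - e - 1)"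
        using True by (simp add: powr_add[symmetric] diff_diff_eq add.commute)
      also have "ennreal (1 / D * l powr (r - e - 1)) * (\<integral>\<^sup>+y. ennreal (f y) * indicator {D * l powr e<..} (f y) \<partial>lborel)
         = (\<integral>\<^sup>+y. ennreal (1 / D * l powr (r - e - 1)) * (ennreal (f y) * indicator {D * l powr e<..} (f y)) \<partial>lborel)"
        by (rule nn_integral_cmult[symmetric]) measurable
      also have "\<dots> = (\<integral>\<^sup>+y. ennreal (1 / D) * (ennreal (f y) *
      (ennreal (l powr (r - e - 1)) * (indicator {0<..} l * indicator {D * l powr e<..} (f y)))) \<partial>lborel)"
      proof -
        have "ennreal (l powr (r - e - 1) / D) = ennreal (1 / D) * ennreal (l powr (r - e - 1))"
          using D0 by (simp add: ennreal_mult'[symmetric])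
        then show ?thesis
          using True by (intro nn_integral_cong) (simp add: mult_ac)
      qed
      finally show ?thesis .
    qed simp
  qed
  also have "\<dots> = (\<integral>\<^sup>+y. (\<integral>\<^sup>+l. ennreal (1 / D) * (ennreal (f y) *
      (ennreal (l powr (r - e - 1)) * (indicator {0<..} l * indicator {D * l powr e<..} (f y)))) \<partial>lborel) \<partial>lborel)"
    by (rule lborel_pair.Fubini') measurable
  also have "\<dots> = (\<integral>\<^sup>+y. ennreal (D powr (- s) / (e * (s - 1))) * ennreal (f y powr s) \<partial>lborel)"
  proof (rule nn_integral_cong)
    fix y
    have "(\<integral>\<^sup>+l. ennreal (1 / D) * (ennreal (f y) *
      (ennreal (l powr (r - e - 1)) * (indicator {0<..} l * indicator {D * l powr e<..} (f y)))) \<partial>lborel)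
      = ennreal (1 / D) * (ennreal (f y) * ennreal (f y powr (s - 1) * D powr (1 - s) / (e * (s - 1))))"
      unfolding inner[symmetric] by (subst nn_integral_cmult, measurable, subst nn_integral_cmult, measurable)
    also have "\<dots> = ennreal (1 / D * (f y * (f y powr (s - 1) * D powr (1 - s) / (e * (s - 1)))))"
      using D0 f0 by (simp only: ennreal_mult'[symmetric] zero_le_divide_1_iff less_imp_le)
    also have "1 / D * (f y * (f y powr (s - 1) * D powr (1 - s) / (e * (s - 1))))
      = (D powr (- 1) * D powr (1 - s)) / (e * (s - 1)) * (f y powr 1 * f y powr (s - 1))"
      using D0 f0[of y] by (simp add: powr_minus_divide)
    also have "\<dots> = D powr (- s) / (e * (s - 1)) * f y powr s"
      using D0 f0[of y] by (simp only: powr_add[symmetric]) simp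
    finally show "(\<integral>\<^sup>+l. ennreal (1 / D) * (ennreal (f y) *
      (ennreal (l powr (r - e - 1)) * (indicator {0<..} l * indicator {D * l powr e<..} (f y)))) \<partial>lborel)
      = ennreal (D powr (- s) / (e * (s - 1))) * ennreal (f y powr s)"
      using e0 s by (simp add: ennreal_mult'[symmetric])
  qed
  also have "\<dots> = ennreal (D powr (- s) / (e * (s - 1))) * (\<integral>\<^sup>+y. ennreal (f y powr s) \<partial>lborel)"
    by (rule nn_integral_cmult) measurable
  also have "\<dots> \<le> ennreal (D powr (- s) / (e * (s - 1))) * 1"
    by (intro mult_left_mono norm) auto
  finally have double_integral: "(\<integral>\<^sup>+x. (\<integral>\<^sup>+l. ennreal (l powr (r - 1)) * (indicator {0<..} l * indicator {3 * l<..} (F x)) \<partial>lborel) \<partial>lborel)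
    \<le> ennreal (D powr (- s) / (e * (s - 1))) * 1" .
  have "(\<integral>\<^sup>+x. ennreal (F x powr r) \<partial>lborel)
    = ennreal (3 powr r * r) * (\<integral>\<^sup>+x. (\<integral>\<^sup>+l. ennreal (l powr (r - 1)) * (indicator {0<..} l * indicator {3 * l<..} (F x)) \<partial>lborel) \<partial>lborel)"
    unfolding layer by (rule nn_integral_cmult) measurable
  also have "\<dots> \<le> ennreal (3 powr r * r) * (ennreal (D powr (- s) / (e * (s - 1))) * 1)"
    by (intro mult_left_mono double_integral) simp
  also have "\<dots> = ennreal (3 powr r * r * (D powr (- s) / (e * (s - 1))))"
    using r0 by (simp add: ennreal_mult'[symmetric])
  also have "3 powr r * r * (D powr (- s) / (e * (s - 1))) = 3 powr r * (s / (s - 1)) * D powr (- s)"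
    using r0 s by (simp add: e field_simps)
  finally show ?thesis .
qed

section \<open>The three potential operators as truncated Riesz potentials\<close>

text \<open>
  The operators \<open>I\<close>, \<open>R\<close> and \<open>W\<close> differ only in the part of the square over which the kernel acts: all of
  it, the part with \<open>y \<le> x\<close>, and the part with \<open>x \<le> y\<close>. Writing the kernel as a product with a
  negative power also agrees with the quotient on the diagonal, where both are \<open>0\<close>.
\<close>

definition kernel_op :: "(real \<times> real) set \<Rightarrow> real \<Rightarrow> (real \<Rightarrow> real) \<Rightarrow> real \<Rightarrow> real" where
  "kernel_op S \<alpha> f x = (LINT y:{y\<in>{0..1}. (x, y) \<in> S}|lebesgue. f y * \<bar>x - y\<bar> powr (\<alpha> - 1))"

lemma I_op_eq_kernel_op: "I_op \<alpha> f x = kernel_op UNIV \<alpha> f x"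
  unfolding I_op_def kernel_op_def set_lebesgue_integral_def
  by (intro Bochner_Integration.integral_cong refl)
    (auto simp: powr_minus_divide[of _ "1 - \<alpha>", simplified] split: split_indicator)

lemma R_op_eq_kernel_op:
  assumes "x \<in> {0..1}"
  shows "R_op \<alpha> f x = kernel_op {(x, y). y \<le> x} \<alpha> f x"
  unfolding R_op_def kernel_op_def set_lebesgue_integral_def using assms
  by (intro Bochner_Integration.integral_cong refl)
    (auto simp: powr_minus_divide[of _ "1 - \<alpha>", simplified] split: split_indicator)

lemma W_op_eq_kernel_op:
  assumes "x \<in> {0..1}"
  shows "W_op \<alpha> f x = kernel_op {(x, y). x \<le> y} \<alpha> f x"
  unfolding W_op_def kernel_op_def set_lebesgue_integral_def using assms
  by (intro Bochner_Integration.integral_cong refl)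
    (auto simp: powr_minus_divide[of _ "1 - \<alpha>", simplified] split: split_indicator)

text \<open>
  Lebesgue measurable functions are replaced by Borel ones, because measurability in the product
  space and Tonelli's theorem are used with Borel measure.
\<close>

lemma borel_representative:
  fixes f :: "real \<Rightarrow> real"
  assumes "f \<in> borel_measurable (lebesgue_on {0..1})"
  obtains g where "g \<in> borel_measurable borel" "\<And>y. y \<notin> {0..1} \<Longrightarrow> g y = 0"
    "AE y in lebesgue. y \<in> {0..1} \<longrightarrow> f y = g y"
proof -
  have "(\<lambda>y. if y \<in> {0..1} then f y else 0) \<in> borel_measurable lebesgue"
    using assms by (intro borel_measurable_if_I) auto
  then obtain h where [measurable]: "h \<in> borel_measurable lborel"
    and h: "AE y in lborel. (if y \<in> {0..1} then f y else 0) = h y"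
    using completion_ex_borel_measurable_real by blast
  show thesis
  proof
    show "(\<lambda>y. h y * indicator {0..1} y) \<in> borel_measurable borel"
      by measurable
    show "AE y in lebesgue. y \<in> {0..1} \<longrightarrow> f y = h y * indicator {0..1} y"
      using AE_completion[OF h] by eventually_elim auto
  qed auto
qed

lemma kernel_op_borel_representative:
  fixes f g :: "real \<Rightarrow> real"
  assumes f: "f \<in> borel_measurable (lebesgue_on {0..1})"
    and [measurable]: "g \<in> borel_measurable borel" and S [measurable]: "S \<in> sets borel"
    and g0: "\<And>y. y \<notin> {0..1} \<Longrightarrow> g y = 0"
    and fg: "AE y in lebesgue. y \<in> {0..1} \<longrightarrow> f y = g y"
  shows "kernel_op S \<alpha> f x = (\<integral>y. indicator S (x, y) * (g y * \<bar>x - y\<bar> powr (\<alpha> - 1)) \<partial>lborel)"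
proof -
  have [measurable]: "(\<lambda>y. if y \<in> {0..1} then f y else 0) \<in> borel_measurable lebesgue"
    using f by (intro borel_measurable_if_I) auto
  have [measurable]: "S \<in> sets (borel \<Otimes>\<^sub>M borel)"
    using S by (subst borel_prod)
  have m: "(\<lambda>y. indicator S (x, y) * (g y * \<bar>x - y\<bar> powr (\<alpha> - 1))) \<in> borel_measurable lborel"
    by measurable
  have m2: "(\<lambda>y. indicator S (x, y) * \<bar>x - y\<bar> powr (\<alpha> - 1)) \<in> borel_measurable lborel"
    by measurable
  have "kernel_op S \<alpha> f x = (\<integral>y. (indicator S (x, y) * \<bar>x - y\<bar> powr (\<alpha> - 1)) * (if y \<in> {0..1} then f y else 0) \<partial>lebesgue)"
    unfolding kernel_op_def set_lebesgue_integral_def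
    by (intro Bochner_Integration.integral_cong refl) (auto split: split_indicator)
  also have "\<dots> = (\<integral>y. indicator S (x, y) * (g y * \<bar>x - y\<bar> powr (\<alpha> - 1)) \<partial>lebesgue)"
  proof (rule integral_cong_AE)
    show "(\<lambda>y. (indicator S (x, y) * \<bar>x - y\<bar> powr (\<alpha> - 1)) * (if y \<in> {0..1} then f y else 0))
        \<in> borel_measurable lebesgue"
      using measurable_completion[OF m2] by measurable
    show "AE y in lebesgue. (indicator S (x, y) * \<bar>x - y\<bar> powr (\<alpha> - 1)) * (if y \<in> {0..1} then f y else 0)
        = indicator S (x, y) * (g y * \<bar>x - y\<bar> powr (\<alpha> - 1))"
      using fg by eventually_elim (auto simp: g0)
  qed (rule measurable_completion[OF m])
  also have "\<dots> = (\<integral>y. indicator S (x, y) * (g y * \<bar>x - y\<bar> powr (\<alpha> - 1)) \<partial>lborel)"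
    using m by (rule integral_completion)
  finally show ?thesis .
qed

lemma kernel_op_measurable:
  assumes f: "f \<in> borel_measurable (lebesgue_on {0..1})" and S [measurable]: "S \<in> sets borel"
  shows "kernel_op S \<alpha> f \<in> borel_measurable borel"
proof -
  obtain g where g: "g \<in> borel_measurable borel" "\<And>y. y \<notin> {0..1} \<Longrightarrow> g y = 0"
    "AE y in lebesgue. y \<in> {0..1} \<longrightarrow> f y = g y"
    using borel_representative[OF f] by blast
  note [measurable] = g(1)
  have [measurable]: "S \<in> sets (borel \<Otimes>\<^sub>M borel)"
    using S by (subst borel_prod)
  have "kernel_op S \<alpha> f = (\<lambda>x. \<integral>y. indicator S (x, y) * (g y * \<bar>x - y\<bar> powr (\<alpha> - 1)) \<partial>lborel)"
    using f g by (intro ext kernel_op_borel_representative) auto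
  also have "\<dots> \<in> borel_measurable borel"
    by (rule lborel.borel_measurable_lebesgue_integral) measurable
  finally show ?thesis .
qed

text \<open>
  The Hardy--Littlewood--Sobolev inequality applies to \<open>\<bar>f\<bar> / A\<close>, extended by \<open>0\<close> outside the unit
  interval, since \<open>\<bar>kernel_op S \<alpha> f\<bar>\<close> is at most the potential of \<open>\<bar>f\<bar>\<close>. At points where the
  defining integral diverges the operator has the value \<open>0\<close>, so the pointwise bound holds there too.
\<close>

lemma kernel_op_bound:
  fixes f :: "real \<Rightarrow> real" and A \<alpha> s r B D :: real
  assumes f: "f \<in> borel_measurable (lebesgue_on {0..1})" and S: "S \<in> sets borel"
    and s: "1 < s" "0 < \<alpha>" "\<alpha> * s < 1" and r: "r = s / (1 - \<alpha> * s)"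
    and A: "0 < A" "(\<integral>\<^sup>+y\<in>{0..1}. ennreal (\<bar>f y\<bar> powr s) \<partial>lebesgue) \<le> ennreal (A powr s)"
    and B: "1 + 2 * (s - 1) / (1 - \<alpha> * s) \<le> B"
    and D: "D = \<alpha> / 2 * B powr (- (\<alpha> * r))"
  shows "(\<integral>\<^sup>+x\<in>{0..1}. ennreal (\<bar>kernel_op S \<alpha> f x\<bar> powr r) \<partial>lebesgue)
    \<le> ennreal (3 powr r * (s / (s - 1)) * D powr (- s) * A powr r)"
proof -
  obtain g where g: "g \<in> borel_measurable borel" "\<And>y. y \<notin> {0..1} \<Longrightarrow> g y = 0"
    "AE y in lebesgue. y \<in> {0..1} \<longrightarrow> f y = g y"
    using borel_representative[OF f] by blast
  note [measurable] = g(1) S kernel_op_measurable[OF f S]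
  define F where "F = (\<lambda>x. \<bar>kernel_op S \<alpha> f x\<bar> / A)"
  define h where "h = (\<lambda>y. \<bar>g y\<bar> / A)"
  have "(\<integral>\<^sup>+y. ennreal (\<bar>g y\<bar> powr s) \<partial>lborel) = (\<integral>\<^sup>+y. ennreal (\<bar>g y\<bar> powr s) \<partial>lebesgue)"
    by (rule nn_integral_completion[symmetric])
  also have "\<dots> = (\<integral>\<^sup>+y\<in>{0..1}. ennreal (\<bar>f y\<bar> powr s) \<partial>lebesgue)"
  proof (rule nn_integral_cong_AE)
    show "AE y in lebesgue. ennreal (\<bar>g y\<bar> powr s) = ennreal (\<bar>f y\<bar> powr s) * indicator {0..1} y"
      using g(3) by eventually_elim (auto simp: g(2) split: split_indicator)
  qed
  finally have gs: "(\<integral>\<^sup>+y. ennreal (\<bar>g y\<bar> powr s) \<partial>lborel) \<le> ennreal (A powr s)"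
    using A by simp
  have "(\<integral>\<^sup>+y. ennreal (h y powr s) \<partial>lborel) = (\<integral>\<^sup>+y. ennreal (A powr (- s)) * ennreal (\<bar>g y\<bar> powr s) \<partial>lborel)"
    using A by (intro nn_integral_cong) (simp add: h_def powr_divide powr_minus_divide ennreal_mult'[symmetric])
  also have "\<dots> = ennreal (A powr (- s)) * (\<integral>\<^sup>+y. ennreal (\<bar>g y\<bar> powr s) \<partial>lborel)"
    by (rule nn_integral_cmult) measurable
  also have "\<dots> \<le> ennreal (A powr (- s)) * ennreal (A powr s)"
    by (intro mult_left_mono gs) auto
  also have "\<dots> = 1"
    using A by (simp add: ennreal_mult'[symmetric] powr_add[symmetric])
  finally have norm: "(\<integral>\<^sup>+y. ennreal (h y powr s) \<partial>lborel) \<le> 1" .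
  have FU: "ennreal (F x) \<le> (\<integral>\<^sup>+y. ennreal (h y * \<bar>x - y\<bar> powr (\<alpha> - 1)) \<partial>lborel)" for x
  proof -
    define u where "u = (\<lambda>y. indicator S (x, y) * (g y * \<bar>x - y\<bar> powr (\<alpha> - 1)))"
    have k: "kernel_op S \<alpha> f x = integral\<^sup>L lborel u"
      unfolding u_def using f g S by (intro kernel_op_borel_representative) auto
    have "ennreal \<bar>kernel_op S \<alpha> f x\<bar> \<le> (\<integral>\<^sup>+y. ennreal \<bar>u y\<bar> \<partial>lborel)"
    proof (cases "integrable lborel u")
      case True
      then show ?thesis
        using integral_norm_bound_ennreal[OF True] by (simp add: k)
    next
      case False
      then show ?thesis
        by (simp add: k not_integrable_integral_eq)
    qed
    also have "\<dots> \<le> (\<integral>\<^sup>+y. ennreal A * ennreal (h y * \<bar>x - y\<bar> powr (\<alpha> - 1)) \<partial>lborel)"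
      using A by (intro nn_integral_mono)
        (auto simp: u_def h_def ennreal_mult'[symmetric] abs_mult split: split_indicator)
    also have "\<dots> = ennreal A * (\<integral>\<^sup>+y. ennreal (h y * \<bar>x - y\<bar> powr (\<alpha> - 1)) \<partial>lborel)"
      unfolding h_def by (rule nn_integral_cmult) measurable
    finally have "ennreal (1 / A) * ennreal \<bar>kernel_op S \<alpha> f x\<bar>
      \<le> ennreal (1 / A) * (ennreal A * (\<integral>\<^sup>+y. ennreal (h y * \<bar>x - y\<bar> powr (\<alpha> - 1)) \<partial>lborel))"
      by (rule mult_left_mono) auto
    then show ?thesis
      using A by (simp add: F_def ennreal_mult'[symmetric] mult.assoc[symmetric])
  qed
  have hls: "(\<integral>\<^sup>+x. ennreal (F x powr r) \<partial>lborel) \<le> ennreal (3 powr r * (s / (s - 1)) * D powr (- s))"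
    by (rule hardy_littlewood_sobolev[where f = h, OF _ _ _ _ s r norm FU B D])
      (use A in \<open>auto simp: h_def F_def\<close>)
  have "(\<integral>\<^sup>+x\<in>{0..1}. ennreal (\<bar>kernel_op S \<alpha> f x\<bar> powr r) \<partial>lebesgue)
    \<le> (\<integral>\<^sup>+x. ennreal (A powr r) * ennreal (F x powr r) \<partial>lebesgue)"
    using A by (intro nn_integral_mono)
      (auto simp: F_def powr_divide ennreal_mult'[symmetric] split: split_indicator)
  also have "\<dots> = (\<integral>\<^sup>+x. ennreal (A powr r) * ennreal (F x powr r) \<partial>lborel)"
    by (rule nn_integral_completion)
  also have "\<dots> = ennreal (A powr r) * (\<integral>\<^sup>+x. ennreal (F x powr r) \<partial>lborel)"
    unfolding F_def by (rule nn_integral_cmult) measurable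
  also have "\<dots> \<le> ennreal (A powr r) * ennreal (3 powr r * (s / (s - 1)) * D powr (- s))"
    by (intro mult_left_mono hls) auto
  also have "\<dots> = ennreal (3 powr r * (s / (s - 1)) * D powr (- s) * A powr r)"
    by (simp add: ennreal_mult'[symmetric] mult_ac)
  finally show ?thesis .
qed

text \<open>
  The constant of the Hardy--Littlewood--Sobolev inequality with each ingredient replaced by a bound
  that is valid for all exponents in \<open>{p\<^sub>0..p}\<close>; it is finite as \<open>p\<^sub>0 > 1\<close> and \<open>\<alpha> p < 1\<close>.
\<close>

definition hls_uniform_const :: "real \<Rightarrow> real \<Rightarrow> real \<Rightarrow> real" where
  "hls_uniform_const \<alpha> p\<^sub>0 p = 3 powr (p / (1 - \<alpha> * p)) * (p / (p\<^sub>0 - 1)) *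
    (\<alpha> / 2 * (1 + 2 * p / (1 - \<alpha> * p)) powr (- (\<alpha> * (p / (1 - \<alpha> * p))))) powr (- p)"

lemma
  fixes p\<^sub>0 p \<alpha> :: real
  assumes p: "1 < p\<^sub>0" "p\<^sub>0 \<le> p" and \<alpha>: "0 < \<alpha>" "\<alpha> * p < 1"
  shows hls_uniform_const_ge_1: "1 \<le> hls_uniform_const \<alpha> p\<^sub>0 p"
    and kernel_op_uniform_bound: "s \<in> {p\<^sub>0..p} \<Longrightarrow> f \<in> borel_measurable (lebesgue_on {0..1}) \<Longrightarrow> S \<in> sets borel \<Longrightarrow> 0 < A \<Longrightarrow>
      (\<integral>\<^sup>+y\<in>{0..1}. ennreal (\<bar>f y\<bar> powr s) \<partial>lebesgue) \<le> ennreal (A powr s) \<Longrightarrow>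
      (\<integral>\<^sup>+x\<in>{0..1}. ennreal (\<bar>kernel_op S \<alpha> f x\<bar> powr (s / (1 - \<alpha> * s))) \<partial>lebesgue)
        \<le> ennreal (hls_uniform_const \<alpha> p\<^sub>0 p * A powr (s / (1 - \<alpha> * s)))"
proof -
  define q where "q = p / (1 - \<alpha> * p)"
  define B where "B = 1 + 2 * p / (1 - \<alpha> * p)"
  define D\<^sub>0 where "D\<^sub>0 = \<alpha> / 2 * B powr (- (\<alpha> * q))"
  define G where "G = 3 powr q * (p / (p\<^sub>0 - 1)) * D\<^sub>0 powr (- p)"
  have G: "hls_uniform_const \<alpha> p\<^sub>0 p = G"
    by (simp add: hls_uniform_const_def G_def D\<^sub>0_def B_def q_def)
  have B1: "1 \<le> B"
    using p \<alpha> by (simp add: B_def)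
  have D0: "0 < D\<^sub>0"
    using B1 \<alpha> by (simp add: D\<^sub>0_def)
  have q0: "0 < q"
    using p \<alpha> by (simp add: q_def)
  have "\<alpha> < 1"
    using p \<alpha> mult_left_mono[of 1 p \<alpha>] by linarith
  moreover have "B powr (- (\<alpha> * q)) \<le> B powr 0"
    using B1 \<alpha> q0 by (intro powr_mono) auto
  ultimately have "D\<^sub>0 \<le> 1 * 1"
    unfolding D\<^sub>0_def using B1 \<alpha> by (intro mult_mono) auto
  then have D1: "D\<^sub>0 \<le> 1"
    by simp
  have "D\<^sub>0 powr 0 \<le> D\<^sub>0 powr (- p)"
    using p D0 D1 by (intro powr_mono') auto
  then have "1 * 1 * 1 \<le> G"
    unfolding G_def using p q0 D0
    by (intro mult_mono) (auto simp: field_simps intro: ge_one_powr_ge_zero)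
  then show "1 \<le> hls_uniform_const \<alpha> p\<^sub>0 p"
    by (simp add: G)
  show "(\<integral>\<^sup>+x\<in>{0..1}. ennreal (\<bar>kernel_op S \<alpha> f x\<bar> powr (s / (1 - \<alpha> * s))) \<partial>lebesgue)
        \<le> ennreal (hls_uniform_const \<alpha> p\<^sub>0 p * A powr (s / (1 - \<alpha> * s)))"
    if s: "s \<in> {p\<^sub>0..p}" and f: "f \<in> borel_measurable (lebesgue_on {0..1})" and S: "S \<in> sets borel"
      and A: "0 < A" "(\<integral>\<^sup>+y\<in>{0..1}. ennreal (\<bar>f y\<bar> powr s) \<partial>lebesgue) \<le> ennreal (A powr s)"
  proof -
    define r where "r = s / (1 - \<alpha> * s)"
    define D where "D = \<alpha> / 2 * B powr (- (\<alpha> * r))"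
    have "\<alpha> * s \<le> \<alpha> * p"
      using s \<alpha> by (intro mult_left_mono) auto
    then have \<alpha>s: "\<alpha> * s < 1" "1 - \<alpha> * p \<le> 1 - \<alpha> * s"
      using \<alpha> by linarith+
    have r0: "0 < r"
      unfolding r_def using s p \<alpha>s(1) by (intro divide_pos_pos) auto
    have "r \<le> q"
      unfolding r_def q_def using s p \<alpha> \<alpha>s by (intro frac_le) auto
    note rq = r0 this
    have Bs: "1 + 2 * (s - 1) / (1 - \<alpha> * s) \<le> B"
      unfolding B_def using s p \<alpha> \<alpha>s by (intro add_left_mono frac_le) auto
    have "D\<^sub>0 \<le> D"
      unfolding D\<^sub>0_def D_def using B1 rq \<alpha> by (intro mult_left_mono powr_mono) auto
    then have "D powr (- s) \<le> D\<^sub>0 powr (- s)"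
      using D0 s p by (intro powr_mono2') auto
    also have "\<dots> \<le> D\<^sub>0 powr (- p)"
      using D0 D1 s by (intro powr_mono') auto
    finally have Ds: "D powr (- s) \<le> D\<^sub>0 powr (- p)" .
    have "3 powr r * (s / (s - 1)) * D powr (- s) \<le> G"
      unfolding G_def using rq s p Ds by (intro mult_mono powr_mono frac_le) auto
    then have "3 powr r * (s / (s - 1)) * D powr (- s) * A powr r \<le> G * A powr r"
      by (intro mult_right_mono) auto
    then show ?thesis
      using order_trans[OF kernel_op_bound[OF f S _ \<alpha>(1) \<alpha>s(1) r_def A Bs D_def] ennreal_leI] s p
      unfolding r_def G by auto
  qed
qed

section \<open>Boundedness at and above the threshold\<close>

lemma ennreal_powr_le_iff:
  assumes "0 < s" "0 \<le> M"
  shows "ennreal_powr X (1 / s) \<le> ennreal M \<longleftrightarrow> X \<le> ennreal (M powr s)"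
proof (cases X)
  case (real x)
  have "x powr (1 / s) \<le> M \<longleftrightarrow> x \<le> M powr s"
  proof
    assume "x powr (1 / s) \<le> M"
    then have "(x powr (1 / s)) powr s \<le> M powr s"
      using assms by (intro powr_mono2) auto
    then show "x \<le> M powr s"
      using assms real by (simp add: powr_powr)
  next
    assume "x \<le> M powr s"
    then have "x powr (1 / s) \<le> (M powr s) powr (1 / s)"
      using assms real by (intro powr_mono2) auto
    then show "x powr (1 / s) \<le> M"
      using assms by (simp add: powr_powr)
  qed
  then show ?thesis
    using assms real by (simp add: ennreal_powr_def)
qed (simp add: ennreal_powr_def top_unique)

text \<open>
  Removing the outer power turns a norm bound into a family of bounds on plain integrals; all norm
  estimates below are made in this form.
\<close>

lemma grand_norm_le_iff:
  assumes "0 \<le> M"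
  shows "grand_norm r \<theta> f \<le> ennreal M \<longleftrightarrow> (\<forall>\<epsilon>\<in>{0<..<r - 1}.
    ennreal (\<epsilon> powr \<theta>) * (\<integral>\<^sup>+t\<in>{0..1}. ennreal (\<bar>f t\<bar> powr (r - \<epsilon>)) \<partial>lebesgue)
      \<le> ennreal (M powr (r - \<epsilon>)))"
  unfolding grand_norm_def SUP_le_iff
  using assms by (intro ball_cong refl ennreal_powr_le_iff) auto

lemma grand_space_cong:
  assumes "\<And>x. x \<in> {0..1} \<Longrightarrow> f x = g x"
  shows "grand_norm r \<theta> f = grand_norm r \<theta> g" "f \<in> grand_space r \<theta> \<longleftrightarrow> g \<in> grand_space r \<theta>"
proof -
  have "(\<integral>\<^sup>+t\<in>{0..1}. ennreal (\<bar>f t\<bar> powr s) \<partial>lebesgue) = (\<integral>\<^sup>+t\<in>{0..1}. ennreal (\<bar>g t\<bar> powr s) \<partial>lebesgue)" for s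
    by (intro nn_integral_cong) (auto simp: assms split: split_indicator)
  then show 1: "grand_norm r \<theta> f = grand_norm r \<theta> g"
    by (simp add: grand_norm_def)
  have "f \<in> borel_measurable (lebesgue_on {0..1}) \<longleftrightarrow> g \<in> borel_measurable (lebesgue_on {0..1})"
    by (intro measurable_cong) (simp add: assms)
  then show "f \<in> grand_space r \<theta> \<longleftrightarrow> g \<in> grand_space r \<theta>"
    by (simp add: grand_space_def 1)
qed

text \<open>
  Given \<open>\<eta>\<close> in the target norm, put \<open>r = q - \<eta>\<close>. If \<open>r\<close> is close to \<open>q\<close>, then the operator maps
  \<open>L\<^sup>s\<close> to \<open>L\<^sup>r\<close> for \<open>s = r / (1 + \<alpha> r)\<close> with a uniform constant, and \<open>s = p - \<epsilon>\<close>, where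
  \<open>\<epsilon> \<ge> k \<eta>\<close> for a constant \<open>k > 0\<close>. The source norm gives an \<open>L\<^sup>s\<close> norm of at most
  \<open>M * \<epsilon> powr (- (\<theta>\<^sub>1 / s))\<close>, so what remains is to bound \<open>\<eta> powr (\<theta>\<^sub>2 - \<theta>\<^sub>1 * r / s)\<close>. Since
  \<open>r / s = 1 + \<alpha> r < 1 + \<alpha> q\<close>, the exponent is nonnegative by the assumption on
  \<open>\<theta>\<^sub>2\<close>. For the smaller \<open>r\<close>, the target exponent \<open>r\<^sub>0\<close> belonging to a fixed \<open>p\<^sub>0 < p\<close> suffices, because
  the unit interval has finite measure.
\<close>

lemma grand_norm_kernel_op_le:
  fixes p q \<alpha> \<theta>\<^sub>1 \<theta>\<^sub>2 :: real
  assumes p: "1 < p" and \<alpha>: "0 < \<alpha>" "\<alpha> * p < 1" and q: "q = p / (1 - \<alpha> * p)"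
    and \<theta>: "0 < \<theta>\<^sub>1" "(1 + \<alpha> * q) * \<theta>\<^sub>1 \<le> \<theta>\<^sub>2"
  obtains c where "0 < c"
    "\<And>f S M. f \<in> borel_measurable (lebesgue_on {0..1}) \<Longrightarrow> S \<in> sets borel \<Longrightarrow> 0 < M \<Longrightarrow>
      grand_norm p \<theta>\<^sub>1 f \<le> ennreal M \<Longrightarrow> grand_norm q \<theta>\<^sub>2 (kernel_op S \<alpha> f) \<le> ennreal (c * M)"
proof -
  define p\<^sub>0 where "p\<^sub>0 = (1 + p) / 2"
  have p0: "1 < p\<^sub>0" "p\<^sub>0 < p"
    using p by (auto simp: p\<^sub>0_def)
  have "\<alpha> * p\<^sub>0 < \<alpha> * p"
    using \<alpha> p0 by (intro mult_strict_left_mono) auto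
  then have \<alpha>p0: "0 < 1 - \<alpha> * p\<^sub>0" "1 - \<alpha> * p < 1 - \<alpha> * p\<^sub>0"
    using \<alpha> by linarith+
  define r\<^sub>0 where "r\<^sub>0 = p\<^sub>0 / (1 - \<alpha> * p\<^sub>0)"
  have r0: "0 < r\<^sub>0"
    using p0 \<alpha>p0 by (simp add: r\<^sub>0_def)
  have pq: "p < q"
    using p \<alpha> by (simp add: q field_simps)
  have q1: "1 < q"
    using p pq by simp
  have qp: "1 + \<alpha> * q = q / p"
    using p \<alpha> by (simp add: q field_simps)
  have \<theta>2: "0 < \<theta>\<^sub>2"
  proof -
    have "0 < (1 + \<alpha> * q) * \<theta>\<^sub>1"
      using \<theta> \<alpha> q1 by (intro mult_pos_pos add_pos_pos) auto
    then show ?thesis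
      using \<theta> by linarith
  qed
  define G where "G = hls_uniform_const \<alpha> p\<^sub>0 p"
  have G: "1 \<le> G"
    unfolding G_def using p0 \<alpha> by (intro hls_uniform_const_ge_1) auto
  note bound = kernel_op_uniform_bound[OF p0(1) less_imp_le[OF p0(2)] \<alpha>, folded G_def]
  define k where "k = p\<^sub>0 * p / q\<^sup>2"
  have "p\<^sub>0 * p \<le> q * q"
    using p p0 pq by (intro mult_mono) auto
  then have k: "0 < k" "k \<le> 1"
    using p p0 q1 by (auto simp: k_def power2_eq_square field_simps)
  \<comment> \<open>\<open>h\<close> is the loss of the source norm at the fixed exponent \<open>p\<^sub>0\<close>, and \<open>c\<^sub>1\<close> dominates the constants
    of both ranges of \<open>r\<close>. As \<open>c\<^sub>1 \<ge> 1\<close> and \<open>r \<ge> 1\<close>, it may later be moved inside the power \<open>r\<close>.\<close>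
  define h where "h = (p - p\<^sub>0) powr (- (\<theta>\<^sub>1 / p\<^sub>0))"
  define c\<^sub>1 where "c\<^sub>1 = q powr \<theta>\<^sub>2 * k powr (- (\<theta>\<^sub>1 * (1 + \<alpha> * q))) * (1 + G)"
  have k1: "1 \<le> k powr (- (\<theta>\<^sub>1 * (1 + \<alpha> * q)))"
  proof -
    have "k powr 0 \<le> k powr (- (\<theta>\<^sub>1 * (1 + \<alpha> * q)))"
      using k \<theta> \<alpha> q1 by (intro powr_mono') auto
    then show ?thesis
      using k by simp
  qed
  have q2: "1 \<le> q powr \<theta>\<^sub>2"
    using q1 \<theta>2 by (intro ge_one_powr_ge_zero) auto
  have "1 * 1 * 1 \<le> c\<^sub>1"
    unfolding c\<^sub>1_def using G k1 q2 by (intro mult_mono) auto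
  then have c1: "1 \<le> c\<^sub>1"
    by simp
  define c where "c = c\<^sub>1 * max 1 h"
  have "0 < c"
    using c1 by (simp add: c_def)
  moreover have "grand_norm q \<theta>\<^sub>2 (kernel_op S \<alpha> f) \<le> ennreal (c * M)"
    if f: "f \<in> borel_measurable (lebesgue_on {0..1})" and S: "S \<in> sets borel" and M: "0 < M"
      and N: "grand_norm p \<theta>\<^sub>1 f \<le> ennreal M" for f S M
  proof -
    \<comment> \<open>\<open>A \<epsilon>\<close> bounds the Lebesgue norm of \<open>f\<close> with exponent \<open>p - \<epsilon>\<close>.\<close>
    define A where "A = (\<lambda>\<epsilon>. M * \<epsilon> powr (- (\<theta>\<^sub>1 / (p - \<epsilon>))))"
    have A0: "0 < A \<epsilon>" if "0 < \<epsilon>" for \<epsilon>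
      using M that by (simp add: A_def)
    have fA: "(\<integral>\<^sup>+y\<in>{0..1}. ennreal (\<bar>f y\<bar> powr (p - \<epsilon>)) \<partial>lebesgue) \<le> ennreal (A \<epsilon> powr (p - \<epsilon>))"
      if \<epsilon>: "0 < \<epsilon>" "\<epsilon> < p - 1" for \<epsilon>
    proof -
      have "ennreal (\<epsilon> powr \<theta>\<^sub>1) * (\<integral>\<^sup>+y\<in>{0..1}. ennreal (\<bar>f y\<bar> powr (p - \<epsilon>)) \<partial>lebesgue) \<le> ennreal (M powr (p - \<epsilon>))"
        using N M \<epsilon> by (auto simp: grand_norm_le_iff)
      then have "ennreal (\<epsilon> powr (- \<theta>\<^sub>1)) * (ennreal (\<epsilon> powr \<theta>\<^sub>1) * (\<integral>\<^sup>+y\<in>{0..1}. ennreal (\<bar>f y\<bar> powr (p - \<epsilon>)) \<partial>lebesgue))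
          \<le> ennreal (\<epsilon> powr (- \<theta>\<^sub>1)) * ennreal (M powr (p - \<epsilon>))"
        by (intro mult_left_mono) auto
      also have "ennreal (\<epsilon> powr (- \<theta>\<^sub>1)) * ennreal (M powr (p - \<epsilon>)) = ennreal (A \<epsilon> powr (p - \<epsilon>))"
        using M \<epsilon> by (simp add: A_def powr_mult powr_powr ennreal_mult'[symmetric] mult.commute)
      finally show ?thesis
        using \<epsilon> by (simp add: mult.assoc[symmetric] ennreal_mult'[symmetric] powr_add[symmetric])
    qed
    show ?thesis
    proof (subst grand_norm_le_iff, (use M c1 in \<open>simp add: c_def\<close>), rule ballI)
      fix \<eta> assume "\<eta> \<in> {0<..<q - 1}"
      then have \<eta>: "0 < \<eta>" "\<eta> < q - 1"
        by auto
      define r where "r = q - \<eta>"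
      have r: "1 < r" "r < q"
        using \<eta> by (auto simp: r_def)
      define J where "J = (\<integral>\<^sup>+x\<in>{0..1}. ennreal (\<bar>kernel_op S \<alpha> f x\<bar> powr r) \<partial>lebesgue)"
      have "\<exists>u. J \<le> ennreal u \<and> 0 \<le> u \<and> \<eta> powr \<theta>\<^sub>2 * u \<le> c\<^sub>1 * (max 1 h * M) powr r"
      proof (cases "r\<^sub>0 \<le> r")
        case True
        define s where "s = r / (1 + \<alpha> * r)"
        have ar: "0 < 1 + \<alpha> * r"
          using r \<alpha> by (intro add_pos_pos mult_pos_pos) auto
        have rs: "r = s / (1 - \<alpha> * s)"
          using ar r by (simp add: s_def field_simps)
        have rs': "r / s = 1 + \<alpha> * r"
          using ar r by (simp add: s_def)
        have "p\<^sub>0 = r\<^sub>0 / (1 + \<alpha> * r\<^sub>0)"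
          using \<alpha>p0 p0 by (simp add: r\<^sub>0_def field_simps)
        also have "\<dots> \<le> s"
          unfolding s_def using True r0 ar \<alpha> r by (simp add: field_simps add_pos_pos)
        finally have s0: "p\<^sub>0 \<le> s" .
        define \<epsilon> where "\<epsilon> = p - s"
        have "p = q / (1 + \<alpha> * q)"
          using qp p q1 by simp
        then have "\<epsilon> = q / (1 + \<alpha> * q) - r / (1 + \<alpha> * r)"
          by (simp add: \<epsilon>_def s_def)
        also have "\<dots> = \<eta> / ((1 + \<alpha> * q) * (1 + \<alpha> * r))"
        proof -
          have "0 < 1 + \<alpha> * q"
            using \<alpha> q1 by (intro add_pos_pos mult_pos_pos) auto
          then have "q / (1 + \<alpha> * q) - r / (1 + \<alpha> * r)
            = (q * (1 + \<alpha> * r) - r * (1 + \<alpha> * q)) / ((1 + \<alpha> * q) * (1 + \<alpha> * r))"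
            using ar by (simp add: diff_frac_eq)
          also have "q * (1 + \<alpha> * r) - r * (1 + \<alpha> * q) = \<eta>"
            by (simp add: r_def algebra_simps)
          finally show ?thesis .
        qed
        also have "\<dots> = \<eta> * (p * s / (q * r))"
          using qp rs' r q1 p p0 s0 by (simp add: rs'[symmetric])
        finally have \<epsilon>_eq: "\<epsilon> = \<eta> * (p * s / (q * r))" .
        have kle: "k \<le> p * s / (q * r)"
        proof -
          have "p * p\<^sub>0 \<le> p * s" "q * r \<le> q * q"
            using p s0 r q1 by (auto intro!: mult_left_mono)
          then show ?thesis
            unfolding k_def power2_eq_square mult.commute[of p\<^sub>0] using p p0 s0 r q1
            by (intro frac_le) auto
        qed
        have \<epsilon>k: "k * \<eta> \<le> \<epsilon>"
          unfolding \<epsilon>_eq using mult_left_mono[OF kle, of \<eta>] \<eta> by (simp add: mult.commute)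
        have "0 < k * \<eta>"
          using k \<eta> by simp
        then have \<epsilon>: "0 < \<epsilon>" "\<epsilon> < p - 1"
          using \<epsilon>k s0 p0 by (auto simp: \<epsilon>_def)
        have ps: "p - \<epsilon> = s"
          by (simp add: \<epsilon>_def)
        have sp: "s \<in> {p\<^sub>0..p}"
          using s0 \<epsilon> by (simp add: \<epsilon>_def)
        have "J \<le> ennreal (G * A \<epsilon> powr r)"
          using bound[OF sp f S A0[OF \<epsilon>(1)] fA[OF \<epsilon>, unfolded ps]] by (simp add: J_def rs[symmetric])
        moreover have "\<eta> powr \<theta>\<^sub>2 * (G * A \<epsilon> powr r) \<le> c\<^sub>1 * (max 1 h * M) powr r"
        proof -
          have exponent: "0 \<le> \<theta>\<^sub>2 - \<theta>\<^sub>1 * (1 + \<alpha> * r)" "\<theta>\<^sub>2 - \<theta>\<^sub>1 * (1 + \<alpha> * r) \<le> \<theta>\<^sub>2"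
          proof -
            have "\<theta>\<^sub>1 * (1 + \<alpha> * r) \<le> \<theta>\<^sub>1 * (1 + \<alpha> * q)"
              using \<theta> \<alpha> r by (intro mult_left_mono add_left_mono) auto
            then show "0 \<le> \<theta>\<^sub>2 - \<theta>\<^sub>1 * (1 + \<alpha> * r)"
              using \<theta>(2) mult.commute[of "1 + \<alpha> * q" \<theta>\<^sub>1] by linarith
            show "\<theta>\<^sub>2 - \<theta>\<^sub>1 * (1 + \<alpha> * r) \<le> \<theta>\<^sub>2"
              using \<theta> ar by simp
          qed
          have "- (\<theta>\<^sub>1 / s) * r = - (\<theta>\<^sub>1 * (1 + \<alpha> * r))"
            by (simp add: rs'[symmetric])
          then have "A \<epsilon> powr r = M powr r * \<epsilon> powr (- (\<theta>\<^sub>1 * (1 + \<alpha> * r)))"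
            unfolding A_def ps by (simp add: powr_mult powr_powr)
          moreover have "\<epsilon> powr (- (\<theta>\<^sub>1 * (1 + \<alpha> * r))) \<le> (k * \<eta>) powr (- (\<theta>\<^sub>1 * (1 + \<alpha> * r)))"
            using \<open>0 < k * \<eta>\<close> \<epsilon>k \<theta> ar by (intro powr_mono2') auto
          ultimately have "\<eta> powr \<theta>\<^sub>2 * (G * A \<epsilon> powr r)
            \<le> \<eta> powr \<theta>\<^sub>2 * (G * (M powr r * (k * \<eta>) powr (- (\<theta>\<^sub>1 * (1 + \<alpha> * r)))))"
            using G by (simp add: mult_left_mono)
          also have "\<dots> = \<eta> powr (\<theta>\<^sub>2 - \<theta>\<^sub>1 * (1 + \<alpha> * r)) * k powr (- (\<theta>\<^sub>1 * (1 + \<alpha> * r))) * G * M powr r"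
          proof -
            have "\<eta> powr (\<theta>\<^sub>2 - \<theta>\<^sub>1 * (1 + \<alpha> * r)) = \<eta> powr \<theta>\<^sub>2 * \<eta> powr (- (\<theta>\<^sub>1 * (1 + \<alpha> * r)))"
              by (simp add: powr_add[symmetric])
            then show ?thesis
              by (simp only: powr_mult mult_ac)
          qed
          also have "\<dots> \<le> q powr \<theta>\<^sub>2 * k powr (- (\<theta>\<^sub>1 * (1 + \<alpha> * q))) * (1 + G) * (max 1 h * M) powr r"
          proof (intro mult_mono powr_mono2)
            have "\<eta> powr (\<theta>\<^sub>2 - \<theta>\<^sub>1 * (1 + \<alpha> * r)) \<le> q powr (\<theta>\<^sub>2 - \<theta>\<^sub>1 * (1 + \<alpha> * r))"
              using \<eta> exponent by (intro powr_mono2) auto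
            also have "\<dots> \<le> q powr \<theta>\<^sub>2"
              using q1 exponent by (intro powr_mono) auto
            finally show "\<eta> powr (\<theta>\<^sub>2 - \<theta>\<^sub>1 * (1 + \<alpha> * r)) \<le> q powr \<theta>\<^sub>2" .
            show "k powr (- (\<theta>\<^sub>1 * (1 + \<alpha> * r))) \<le> k powr (- (\<theta>\<^sub>1 * (1 + \<alpha> * q)))"
              using k \<theta> \<alpha> r by (intro powr_mono') auto
            show "M \<le> max 1 h * M"
              using M by simp
          qed (use G M r in auto)
          finally show ?thesis
            by (simp add: c\<^sub>1_def)
        qed
        ultimately show ?thesis
          using G by (intro exI[of _ "G * A \<epsilon> powr r"]) auto
      next
        case False
        define \<epsilon> where "\<epsilon> = p - p\<^sub>0"
        have \<epsilon>: "0 < \<epsilon>" "\<epsilon> < p - 1" and ps: "p - \<epsilon> = p\<^sub>0"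
          using p0 by (auto simp: \<epsilon>_def)
        define a where "a = A \<epsilon>"
        have a: "0 < a" "a = h * M"
          using A0[OF \<epsilon>(1)] by (simp_all add: a_def A_def h_def ps \<epsilon>_def)
        have sp: "p\<^sub>0 \<in> {p\<^sub>0..p}"
          using p0 by simp
        note [measurable] = kernel_op_measurable[OF f S, of \<alpha>]
        have mc: "u \<in> borel_measurable lborel \<Longrightarrow> u \<in> borel_measurable lebesgue" for u :: "real \<Rightarrow> ennreal"
          by (rule measurable_completion)
        have "J \<le> (\<integral>\<^sup>+x. ennreal (a powr r) * indicator {0..1} x + ennreal (a powr (r - r\<^sub>0))
            * (ennreal (\<bar>kernel_op S \<alpha> f x\<bar> powr r\<^sub>0) * indicator {0..1} x) \<partial>lebesgue)"
          unfolding J_def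
        proof (rule nn_integral_mono)
          fix x
          define v where "v = \<bar>kernel_op S \<alpha> f x\<bar>"
          have "v powr r \<le> a powr r + a powr (r - r\<^sub>0) * v powr r\<^sub>0"
          \<comment> \<open>Where \<open>v\<close> exceeds \<open>a\<close>, raising the exponent from \<open>r\<close> to \<open>r\<^sub>0\<close> costs only a power of \<open>a\<close>; elsewhere
            the finite measure of the unit interval is used.\<close>
          proof (cases "v \<le> a")
            case True
            then have "v powr r \<le> a powr r"
              using r by (intro powr_mono2) (auto simp: v_def)
            then show ?thesis
              by (simp add: add_increasing2)
          next
            case va: False
            then have "v powr (r - r\<^sub>0) \<le> a powr (r - r\<^sub>0)"
              using False a by (intro powr_mono2') auto
            then have "v powr (r - r\<^sub>0) * v powr r\<^sub>0 \<le> a powr (r - r\<^sub>0) * v powr r\<^sub>0"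
              by (intro mult_right_mono) auto
            then show ?thesis
              using va a by (simp add: powr_add[symmetric] add_increasing)
          qed
          then show "ennreal (\<bar>kernel_op S \<alpha> f x\<bar> powr r) * indicator {0..1} x
            \<le> ennreal (a powr r) * indicator {0..1} x + ennreal (a powr (r - r\<^sub>0))
            * (ennreal (\<bar>kernel_op S \<alpha> f x\<bar> powr r\<^sub>0) * indicator {0..1} x)"
            unfolding v_def[symmetric]
            by (auto simp: ennreal_mult'[symmetric] ennreal_plus[symmetric] simp del: ennreal_plus
                split: split_indicator intro!: ennreal_leI)
        qed
        also have "\<dots> = ennreal (a powr r) + ennreal (a powr (r - r\<^sub>0))
            * (\<integral>\<^sup>+x\<in>{0..1}. ennreal (\<bar>kernel_op S \<alpha> f x\<bar> powr r\<^sub>0) \<partial>lebesgue)"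
        proof -
          define w where "w = (\<lambda>x. ennreal (\<bar>kernel_op S \<alpha> f x\<bar> powr r\<^sub>0) * indicator {0..1} x)"
          have "w \<in> borel_measurable lborel"
            unfolding w_def by measurable
          then have [measurable]: "w \<in> borel_measurable lebesgue"
            by (rule mc)
          have [measurable]: "(indicator {0..1} :: real \<Rightarrow> ennreal) \<in> borel_measurable lebesgue"
            by (rule mc) simp
          have "(\<integral>\<^sup>+x. ennreal (a powr r) * indicator {0..1} x + ennreal (a powr (r - r\<^sub>0)) * w x \<partial>lebesgue)
            = (\<integral>\<^sup>+x. ennreal (a powr r) * indicator {0..1::real} x \<partial>lebesgue)
              + (\<integral>\<^sup>+x. ennreal (a powr (r - r\<^sub>0)) * w x \<partial>lebesgue)"
            by (rule nn_integral_add) simp_all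
          also have "(\<integral>\<^sup>+x. ennreal (a powr r) * indicator {0..1::real} x \<partial>lebesgue) = ennreal (a powr r)"
            by (simp add: nn_integral_cmult_indicator)
          also have "(\<integral>\<^sup>+x. ennreal (a powr (r - r\<^sub>0)) * w x \<partial>lebesgue)
            = ennreal (a powr (r - r\<^sub>0)) * (\<integral>\<^sup>+x. w x \<partial>lebesgue)"
            by (rule nn_integral_cmult) simp
          finally show ?thesis
            by (simp add: w_def)
        qed
        also have "\<dots> \<le> ennreal (a powr r) + ennreal (a powr (r - r\<^sub>0)) * ennreal (G * a powr r\<^sub>0)"
          using bound[OF sp f S A0[OF \<epsilon>(1)] fA[OF \<epsilon>, unfolded ps]]
          by (intro add_left_mono mult_left_mono) (auto simp: r\<^sub>0_def a_def)
        also have "\<dots> = ennreal (a powr r + a powr (r - r\<^sub>0) * (G * a powr r\<^sub>0))"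
          using G by (simp add: ennreal_mult'[symmetric] ennreal_plus[symmetric] del: ennreal_plus)
        also have "a powr r + a powr (r - r\<^sub>0) * (G * a powr r\<^sub>0) = (1 + G) * a powr r"
          using a by (simp add: powr_diff field_simps)
        finally have "J \<le> ennreal ((1 + G) * a powr r)" .
        moreover have "\<eta> powr \<theta>\<^sub>2 * ((1 + G) * a powr r) \<le> c\<^sub>1 * (max 1 h * M) powr r"
        proof -
          have "\<eta> powr \<theta>\<^sub>2 * 1 * (1 + G) * a powr r
            \<le> q powr \<theta>\<^sub>2 * k powr (- (\<theta>\<^sub>1 * (1 + \<alpha> * q))) * (1 + G) * (max 1 h * M) powr r"
            using \<eta> \<theta>2 G k1 a r M by (intro mult_mono powr_mono2) auto
          then show ?thesis
            by (simp add: c\<^sub>1_def mult.assoc)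
        qed
        ultimately show ?thesis
          using G by (intro exI[of _ "(1 + G) * a powr r"]) auto
      qed
      then obtain u where u: "J \<le> ennreal u" "0 \<le> u" "\<eta> powr \<theta>\<^sub>2 * u \<le> c\<^sub>1 * (max 1 h * M) powr r"
        by blast
      have "c\<^sub>1 powr 1 \<le> c\<^sub>1 powr r"
        using c1 r by (intro powr_mono) auto
      then have "c\<^sub>1 * (max 1 h * M) powr r \<le> c\<^sub>1 powr r * (max 1 h * M) powr r"
        using c1 by (intro mult_right_mono) auto
      also have "\<dots> = (c * M) powr r"
        by (simp add: c_def powr_mult mult.assoc)
      finally have "\<eta> powr \<theta>\<^sub>2 * u \<le> (c * M) powr r"
        using u by linarith
      moreover have "ennreal (\<eta> powr \<theta>\<^sub>2) * J \<le> ennreal (\<eta> powr \<theta>\<^sub>2 * u)"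
        using u by (simp add: ennreal_mult' mult_left_mono)
      ultimately show "ennreal (\<eta> powr \<theta>\<^sub>2) * (\<integral>\<^sup>+x\<in>{0..1}. ennreal (\<bar>kernel_op S \<alpha> f x\<bar> powr (q - \<eta>)) \<partial>lebesgue)
        \<le> ennreal ((c * M) powr (q - \<eta>))"
        unfolding r_def[symmetric] J_def[symmetric] by (meson ennreal_leI order_trans)
    qed
  qed
  ultimately show thesis
    by (rule that)
qed

text \<open>
  The norm bound is applied with \<open>M\<close> slightly larger than the norm of \<open>f\<close>, so that functions of
  norm \<open>0\<close> need no separate treatment.
\<close>

lemma grand_bounded_kernel_op:
  fixes p q \<alpha> \<theta>\<^sub>1 \<theta>\<^sub>2 :: real
  assumes p: "1 < p" and \<alpha>: "0 < \<alpha>" "\<alpha> * p < 1" and q: "q = p / (1 - \<alpha> * p)"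
    and \<theta>: "0 < \<theta>\<^sub>1" "(1 + \<alpha> * q) * \<theta>\<^sub>1 \<le> \<theta>\<^sub>2"
    and S: "S \<in> sets borel"
  shows "grand_bounded (kernel_op S \<alpha>) p \<theta>\<^sub>1 q \<theta>\<^sub>2"
proof -
  show ?thesis
  proof (rule grand_norm_kernel_op_le[OF p \<alpha> q \<theta>])
    fix c
    assume c: "0 < c" and bound: "\<And>f S M. f \<in> borel_measurable (lebesgue_on {0..1}) \<Longrightarrow>
      S \<in> sets borel \<Longrightarrow> 0 < M \<Longrightarrow> grand_norm p \<theta>\<^sub>1 f \<le> ennreal M \<Longrightarrow>
      grand_norm q \<theta>\<^sub>2 (kernel_op S \<alpha> f) \<le> ennreal (c * M)"
  show ?thesis
    unfolding grand_bounded_def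
  proof (intro exI[of _ c] conjI ballI c)
    fix f assume "f \<in> grand_space p \<theta>\<^sub>1"
    then have f: "f \<in> borel_measurable (lebesgue_on {0..1})" and fin: "grand_norm p \<theta>\<^sub>1 f < \<infinity>"
      by (auto simp: grand_space_def)
    obtain N where N: "0 \<le> N" "grand_norm p \<theta>\<^sub>1 f = ennreal N"
      using fin by (cases "grand_norm p \<theta>\<^sub>1 f") auto
    show le: "grand_norm q \<theta>\<^sub>2 (kernel_op S \<alpha> f) \<le> ennreal c * grand_norm p \<theta>\<^sub>1 f"
    proof (rule ennreal_le_epsilon)
      fix e :: real assume e: "0 < e"
      have "grand_norm q \<theta>\<^sub>2 (kernel_op S \<alpha> f) \<le> ennreal (c * (N + e / c))"
        using N c e by (intro bound f S) (auto intro!: ennreal_leI add_nonneg_pos)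
      also have "c * (N + e / c) = c * N + e"
        using c by (simp add: field_simps)
      finally show "grand_norm q \<theta>\<^sub>2 (kernel_op S \<alpha> f) \<le> ennreal c * grand_norm p \<theta>\<^sub>1 f + ennreal e"
        using c N e by (simp add: ennreal_mult)
    qed
    have "kernel_op S \<alpha> f \<in> borel_measurable lebesgue"
      using kernel_op_measurable[OF f S] by (intro measurable_completion) simp
    then have "kernel_op S \<alpha> f \<in> borel_measurable (lebesgue_on {0..1})"
      by (rule measurable_restrict_space1)
    moreover have "ennreal c * grand_norm p \<theta>\<^sub>1 f < \<infinity>"
      using N c by (simp add: ennreal_mult'[symmetric])
    ultimately show "kernel_op S \<alpha> f \<in> grand_space q \<theta>\<^sub>2"
      using le by (auto simp: grand_space_def)
  qed
  qed
qed

section \<open>Failure below the threshold\<close>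

lemma nn_integral_indicator_powr:
  fixes a s :: real
  assumes "0 \<le> a" "a \<le> 1" "0 < s"
  shows "(\<integral>\<^sup>+t\<in>{0..1}. ennreal (\<bar>indicator {0..a} t\<bar> powr s) \<partial>lebesgue) = ennreal a"
proof -
  have "(\<integral>\<^sup>+t\<in>{0..1}. ennreal (\<bar>indicator {0..a} t\<bar> powr s) \<partial>lebesgue)
    = (\<integral>\<^sup>+t. indicator {0..a} t \<partial>lebesgue)"
    using assms by (intro nn_integral_cong) (auto split: split_indicator)
  also have "\<dots> = (\<integral>\<^sup>+t. indicator {0..a} t \<partial>lborel)"
    by (rule nn_integral_completion)
  finally show ?thesis
    using assms by simp
qed

text \<open>
  A bound for \<open>u powr \<theta> * exp (- u / p)\<close> that is uniform in \<open>u\<close>: it controls the supremum over \<open>\<epsilon>\<close> in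
  the norm of an indicator, with \<open>u = \<epsilon> / \<eta>\<close>.
\<close>

lemma powr_le_exp:
  fixes u \<theta> p :: real
  assumes "0 < u" "0 < \<theta>" "0 < p"
  shows "u powr \<theta> \<le> (\<theta> * p) powr \<theta> * exp (u / p)"
proof -
  define v where "v = u / (\<theta> * p)"
  have v: "0 < v"
    using assms by (simp add: v_def)
  have "v \<le> exp v"
    using exp_ge_add_one_self[of v] by linarith
  then have "v powr \<theta> \<le> exp v powr \<theta>"
    using v assms by (intro powr_mono2) auto
  also have "exp v powr \<theta> = exp (u / p)"
    using assms by (simp add: powr_def v_def)
  finally have "(\<theta> * p) powr \<theta> * v powr \<theta> \<le> (\<theta> * p) powr \<theta> * exp (u / p)"
    by (intro mult_left_mono) auto
  moreover have "(\<theta> * p) powr \<theta> * v powr \<theta> = u powr \<theta>"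
    using assms by (simp add: powr_mult[symmetric] v_def)
  ultimately show ?thesis
    by simp
qed

text \<open>
  For small \<open>\<eta>\<close> and the interval of length \<open>exp (- 1 / \<eta>)\<close> the supremum in the norm is
  comparable to the value for \<open>\<epsilon> = \<eta>\<close>. The parameter \<open>\<eta>\<close> replaces the length in order to avoid logarithms.
\<close>

lemma grand_norm_indicator_le:
  fixes p \<theta> \<eta> C :: real
  assumes p: "1 < p" and \<theta>: "0 < \<theta>" and \<eta>: "0 < \<eta>" "\<eta> \<le> 1"
    and C: "C = max 1 ((\<theta> * p) powr \<theta>)"
  shows "grand_norm p \<theta> (indicator {0..exp (- 1 / \<eta>)})
    \<le> ennreal (C * (exp (- 1 / (\<eta> * p)) * \<eta> powr (\<theta> / p)))"
proof (subst grand_norm_le_iff)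
  show "0 \<le> C * (exp (- 1 / (\<eta> * p)) * \<eta> powr (\<theta> / p))"
    by (simp add: C)
  show "\<forall>\<epsilon>\<in>{0<..<p - 1}. ennreal (\<epsilon> powr \<theta>) *
      (\<integral>\<^sup>+t\<in>{0..1}. ennreal (\<bar>indicator {0..exp (- 1 / \<eta>)} t\<bar> powr (p - \<epsilon>)) \<partial>lebesgue)
    \<le> ennreal ((C * (exp (- 1 / (\<eta> * p)) * \<eta> powr (\<theta> / p))) powr (p - \<epsilon>))"
  proof
    fix \<epsilon> assume "\<epsilon> \<in> {0<..<p - 1}"
    then have \<epsilon>: "0 < \<epsilon>" "\<epsilon> < p - 1"
      by auto
    have "(\<epsilon> / \<eta>) powr \<theta> \<le> (\<theta> * p) powr \<theta> * exp (\<epsilon> / \<eta> / p)"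
      using \<epsilon> \<eta> \<theta> p by (intro powr_le_exp) auto
    also have "\<dots> \<le> C * exp (\<epsilon> / \<eta> / p)"
      by (intro mult_right_mono) (auto simp: C)
    finally have "\<epsilon> powr \<theta> \<le> C * exp (\<epsilon> / \<eta> / p) * \<eta> powr \<theta>"
      using \<epsilon> \<eta> by (simp add: powr_divide field_simps)
    then have "\<epsilon> powr \<theta> * exp (- 1 / \<eta>) \<le> C * exp (\<epsilon> / \<eta> / p) * \<eta> powr \<theta> * exp (- 1 / \<eta>)"
      by (intro mult_right_mono) auto
    also have "\<dots> = C * (exp (\<epsilon> / \<eta> / p + - 1 / \<eta>)) * \<eta> powr \<theta>"
      by (simp only: exp_add mult_ac)
    also have "\<epsilon> / \<eta> / p + - 1 / \<eta> = - 1 / (\<eta> * p) * (p - \<epsilon>)"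
      using \<eta> p by (simp add: field_simps)
    also have "C * exp (- 1 / (\<eta> * p) * (p - \<epsilon>)) * \<eta> powr \<theta>
      \<le> C powr (p - \<epsilon>) * exp (- 1 / (\<eta> * p) * (p - \<epsilon>)) * \<eta> powr (\<theta> / p * (p - \<epsilon>))"
    proof (intro mult_mono)
      have "C powr 1 \<le> C powr (p - \<epsilon>)"
        using \<epsilon> by (intro powr_mono) (auto simp: C)
      then show "C \<le> C powr (p - \<epsilon>)"
        by (simp add: C)
      have "\<theta> / p * (p - \<epsilon>) \<le> \<theta> / p * p"
        using \<epsilon> \<theta> p by (intro mult_left_mono) auto
      then show "\<eta> powr \<theta> \<le> \<eta> powr (\<theta> / p * (p - \<epsilon>))"
        using \<eta> p by (intro powr_mono') auto
    qed (auto simp: C)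
    also have "\<dots> = (C * (exp (- 1 / (\<eta> * p)) * \<eta> powr (\<theta> / p))) powr (p - \<epsilon>)"
      by (simp add: powr_mult powr_powr exp_powr_real mult_ac)
    finally have "\<epsilon> powr \<theta> * exp (- 1 / \<eta>)
      \<le> (C * (exp (- 1 / (\<eta> * p)) * \<eta> powr (\<theta> / p))) powr (p - \<epsilon>)" .
    moreover have "(\<integral>\<^sup>+t\<in>{0..1}. ennreal (\<bar>indicator {0..exp (- 1 / \<eta>)} t\<bar> powr (p - \<epsilon>)) \<partial>lebesgue)
      = ennreal (exp (- 1 / \<eta>))"
      using \<epsilon> \<eta> by (intro nn_integral_indicator_powr) auto
    ultimately show "ennreal (\<epsilon> powr \<theta>) *
      (\<integral>\<^sup>+t\<in>{0..1}. ennreal (\<bar>indicator {0..exp (- 1 / \<eta>)} t\<bar> powr (p - \<epsilon>)) \<partial>lebesgue)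
    \<le> ennreal ((C * (exp (- 1 / (\<eta> * p)) * \<eta> powr (\<theta> / p))) powr (p - \<epsilon>))"
      by (simp add: ennreal_mult'[symmetric] ennreal_leI)
  qed
qed

lemma indicator_measurable_lebesgue_on:
  "(indicator {0..a} :: real \<Rightarrow> real) \<in> borel_measurable (lebesgue_on {0..1})"
  by (intro measurable_restrict_space1 measurable_completion) simp

text \<open>
  On an interval of length \<open>a\<close> the kernel is at least \<open>a powr (\<alpha> - 1)\<close>, and half of the interval lies in the
  domain of integration. The diagonal, where the kernel has the value \<open>0\<close>, is a null set.
\<close>

lemma kernel_op_indicator_ge:
  fixes a \<alpha> m x :: real
  assumes \<alpha>: "0 < \<alpha>" "\<alpha> < 1" and a: "0 < a" "a \<le> 1" and S: "S \<in> sets borel"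
    and x: "x \<in> {0..a}" and m: "0 \<le> m" "m + a / 2 \<le> a"
    and sub: "\<And>y. y \<in> {m..m + a / 2} \<Longrightarrow> (x, y) \<in> S"
  shows "a powr \<alpha> / 2 \<le> kernel_op S \<alpha> (indicator {0..a}) x"
proof -
  define u :: "real \<Rightarrow> real" where "u = (\<lambda>y. indicator S (x, y) * (indicator {0..a} y * \<bar>x - y\<bar> powr (\<alpha> - 1)))"
  have [measurable]: "S \<in> sets (borel \<Otimes>\<^sub>M borel)"
    using S by (subst borel_prod)
  have [measurable]: "u \<in> borel_measurable borel"
    unfolding u_def by measurable
  have "kernel_op S \<alpha> (indicator {0..a}) x = integral\<^sup>L lborel u"
    unfolding u_def using a S
    by (intro kernel_op_borel_representative indicator_measurable_lebesgue_on) auto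
  moreover have "a powr \<alpha> / 2 \<le> integral\<^sup>L lborel u"
  proof -
    have "integrable lborel u"
    proof (rule integrableI_bounded)
      have "(\<integral>\<^sup>+y. ennreal (norm (u y)) \<partial>lborel)
        \<le> (\<integral>\<^sup>+y. ennreal (\<bar>x - y\<bar> powr (\<alpha> - 1)) * indicator {..<2} \<bar>x - y\<bar> \<partial>lborel)"
        using x a by (intro nn_integral_mono) (auto simp: u_def split: split_indicator)
      also have "\<dots> < \<infinity>"
        using \<alpha> by (simp add: near_kernel_mass)
      finally show "(\<integral>\<^sup>+y. ennreal (norm (u y)) \<partial>lborel) < \<infinity>" .
    qed simp
    moreover have "integrable lborel (\<lambda>y. a powr (\<alpha> - 1) * indicator {m..m + a / 2} y)"
      by (intro integrable_mult_right integrable_real_indicator) (auto simp: emeasure_lborel_Icc_eq)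
    moreover have "AE y in lborel. a powr (\<alpha> - 1) * indicator {m..m + a / 2} y \<le> u y"
    proof -
      have "AE y in lborel. y \<noteq> x"
        by (rule AE_lborel_singleton)
      then show ?thesis
      proof eventually_elim
        fix y assume yx: "y \<noteq> x"
        show "a powr (\<alpha> - 1) * indicator {m..m + a / 2} y \<le> u y"
        proof (cases "y \<in> {m..m + a / 2}")
          case True
          have "a powr (\<alpha> - 1) \<le> \<bar>x - y\<bar> powr (\<alpha> - 1)"
            using True yx x m a \<alpha> by (intro powr_mono2') auto
          then show ?thesis
            using True sub[OF True] m by (auto simp: u_def)
        qed (auto simp: u_def)
      qed
    qed
    ultimately have "(\<integral>y. a powr (\<alpha> - 1) * indicator {m..m + a / 2} y \<partial>lborel) \<le> integral\<^sup>L lborel u"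
      by (intro integral_mono_AE)
    moreover have "(\<integral>y. a powr (\<alpha> - 1) * indicator {m..m + a / 2} y \<partial>lborel) = a powr \<alpha> / 2"
      using a by (simp add: powr_diff)
    ultimately show ?thesis
      by simp
  qed
  ultimately show ?thesis
    by simp
qed

text \<open>
  The indicators of \<open>{0..a}\<close> with \<open>a = exp (- 1 / \<eta>)\<close> are tested as \<open>\<eta>\<close> tends to \<open>0\<close>. The norm of the image is
  bounded below by taking the same \<open>\<eta>\<close> in the target norm. Because of \<open>1 / p = \<alpha> + 1 / q\<close> the exponentials
  cancel up to the bounded factor \<open>exp (1 / q)\<close>, and a norm inequality would bound
  \<open>\<eta> powr (\<theta>\<^sub>2 - \<theta>\<^sub>1 * (q - \<eta>) / p)\<close>. As \<open>q / p = 1 + \<alpha> q\<close>, the exponent tends to a negative number, so this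
  quantity is unbounded.

  The hypothesis on \<open>S\<close> says that a quarter of the square \<open>{0..a} \<times> {0..a}\<close>, cut at the midpoints, lies in \<open>S\<close>;
  this is what the full square and the two triangles have in common.
\<close>

lemma not_grand_bounded_kernel_op:
  fixes p q \<alpha> \<theta>\<^sub>1 \<theta>\<^sub>2 :: real
  assumes p: "1 < p" and \<alpha>: "0 < \<alpha>" "\<alpha> * p < 1" and q: "q = p / (1 - \<alpha> * p)"
    and \<theta>: "0 < \<theta>\<^sub>1" "\<theta>\<^sub>2 < (1 + \<alpha> * q) * \<theta>\<^sub>1"
    and S: "S \<in> sets borel"
    and box: "\<And>a::real. 0 < a \<Longrightarrow> \<exists>l\<in>{0, a / 2}. \<exists>m\<in>{0, a / 2}. {l..l + a / 2} \<times> {m..m + a / 2} \<subseteq> S"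
  shows "\<not> grand_bounded (kernel_op S \<alpha>) p \<theta>\<^sub>1 q \<theta>\<^sub>2"
proof
  assume "grand_bounded (kernel_op S \<alpha>) p \<theta>\<^sub>1 q \<theta>\<^sub>2"
  then obtain c where c: "0 < c" and bound: "\<And>f. f \<in> grand_space p \<theta>\<^sub>1 \<Longrightarrow>
      grand_norm q \<theta>\<^sub>2 (kernel_op S \<alpha> f) \<le> ennreal c * grand_norm p \<theta>\<^sub>1 f"
    unfolding grand_bounded_def by blast
  have "\<alpha> < 1"
    using p \<alpha> mult_left_mono[of 1 p \<alpha>] by linarith
  have pq: "p < q"
    using p \<alpha> by (simp add: q field_simps)
  have q1: "1 < q"
    using p pq by simp
  have qp: "1 + \<alpha> * q = q / p" and ip: "1 / p = \<alpha> + 1 / q"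
    using p \<alpha> by (simp_all add: q field_simps)
  define g where "g = \<theta>\<^sub>1 * q / p - \<theta>\<^sub>2"
  have g: "0 < g"
    using \<theta> by (simp add: g_def qp mult.commute)
  define C where "C = max 1 ((\<theta>\<^sub>1 * p) powr \<theta>\<^sub>1)"
  define K where "K = 2 * exp (1 / q) * (max 1 (2 * c * C)) powr q"
  have K: "0 < K"
    by (simp add: K_def)
  have small: "\<eta> powr (- (g / 2)) \<le> K"
    if \<eta>: "0 < \<eta>" "\<eta> \<le> 1" "\<eta> < q - 1" "\<eta> \<le> g * p / (2 * \<theta>\<^sub>1)" for \<eta>
  proof -
    define a where "a = exp (- 1 / \<eta>)"
    have a: "0 < a" "a \<le> 1"
      using \<eta> by (auto simp: a_def)
    define X where "X = exp (- 1 / (\<eta> * p)) * \<eta> powr (\<theta>\<^sub>1 / p)"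
    define r where "r = q - \<eta>"
    have r: "1 < r" "r < q"
      using \<eta> by (auto simp: r_def)
    have norm_f: "grand_norm p \<theta>\<^sub>1 (indicator {0..a}) \<le> ennreal (C * X)"
      unfolding a_def X_def using p \<theta> \<eta> by (intro grand_norm_indicator_le) (auto simp: C_def)
    then have "indicator {0..a} \<in> grand_space p \<theta>\<^sub>1"
      unfolding grand_space_def using indicator_measurable_lebesgue_on
      by (auto intro: le_less_trans)
    then have "grand_norm q \<theta>\<^sub>2 (kernel_op S \<alpha> (indicator {0..a})) \<le> ennreal c * grand_norm p \<theta>\<^sub>1 (indicator {0..a})"
      by (rule bound)
    also have "\<dots> \<le> ennreal c * ennreal (C * X)"
      by (intro mult_left_mono norm_f) auto
    also have "\<dots> = ennreal (c * C * X)"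
      using c by (simp add: ennreal_mult'[symmetric] mult.assoc)
    finally have "ennreal (\<eta> powr \<theta>\<^sub>2) * (\<integral>\<^sup>+t\<in>{0..1}. ennreal (\<bar>kernel_op S \<alpha> (indicator {0..a}) t\<bar> powr r) \<partial>lebesgue)
        \<le> ennreal ((c * C * X) powr r)"
      using \<eta> c by (subst (asm) grand_norm_le_iff) (auto simp: r_def C_def X_def)
    moreover have "ennreal ((a powr \<alpha> / 2) powr r * (a / 2))
      \<le> (\<integral>\<^sup>+t\<in>{0..1}. ennreal (\<bar>kernel_op S \<alpha> (indicator {0..a}) t\<bar> powr r) \<partial>lebesgue)"
    proof -
      obtain l m where l: "l \<in> {0, a / 2}" and m: "m \<in> {0, a / 2}"
        and lm: "{l..l + a / 2} \<times> {m..m + a / 2} \<subseteq> S"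
        using box[OF a(1)] by blast
      have "ennreal ((a powr \<alpha> / 2) powr r * (a / 2)) = ennreal ((a powr \<alpha> / 2) powr r) * emeasure lborel {l..l + a / 2}"
        using a by (simp add: ennreal_mult'[symmetric])
      also have "\<dots> = (\<integral>\<^sup>+t. ennreal ((a powr \<alpha> / 2) powr r) * indicator {l..l + a / 2} t \<partial>lborel)"
        by (simp add: nn_integral_cmult_indicator)
      also have "\<dots> = (\<integral>\<^sup>+t. ennreal ((a powr \<alpha> / 2) powr r) * indicator {l..l + a / 2} t \<partial>lebesgue)"
        by (rule nn_integral_completion[symmetric])
      also have "\<dots> \<le> (\<integral>\<^sup>+t\<in>{0..1}. ennreal (\<bar>kernel_op S \<alpha> (indicator {0..a}) t\<bar> powr r) \<partial>lebesgue)"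
      proof (rule nn_integral_mono)
        fix x
        show "ennreal ((a powr \<alpha> / 2) powr r) * indicator {l..l + a / 2} x
          \<le> ennreal (\<bar>kernel_op S \<alpha> (indicator {0..a}) x\<bar> powr r) * indicator {0..1} x"
        proof (cases "x \<in> {l..l + a / 2}")
          case True
          then have x: "x \<in> {0..a}"
            using l a by auto
          have "a powr \<alpha> / 2 \<le> kernel_op S \<alpha> (indicator {0..a}) x"
            using lm True m a x \<alpha> \<open>\<alpha> < 1\<close> S by (intro kernel_op_indicator_ge[where m = m]) auto
          then have "(a powr \<alpha> / 2) powr r \<le> \<bar>kernel_op S \<alpha> (indicator {0..a}) x\<bar> powr r"
            using r by (intro powr_mono2) auto
          then show ?thesis
            using True x a by (auto simp: ennreal_leI split: split_indicator)
        qed simp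
      qed
      finally show ?thesis .
    qed
    ultimately have "ennreal (\<eta> powr \<theta>\<^sub>2) * ennreal ((a powr \<alpha> / 2) powr r * (a / 2)) \<le> ennreal ((c * C * X) powr r)"
      by (meson mult_left_mono order_trans zero_le)
    then have main: "\<eta> powr \<theta>\<^sub>2 * ((a powr \<alpha> / 2) powr r * (a / 2)) \<le> (c * C * X) powr r"
      using a by (simp add: ennreal_mult'[symmetric])
    have "r / p = \<alpha> * r + r / q"
      using arg_cong[OF ip, of "\<lambda>z. r * z"] by (simp add: algebra_simps)
    then have e1: "r / p / \<eta> = \<alpha> * r / \<eta> + r / q / \<eta>"
      by (simp add: add_divide_distrib)
    have e2: "r / q / \<eta> = 1 / \<eta> - 1 / q"
      using \<eta> q1 by (simp add: r_def field_simps)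
    have aX: "exp (- 1 / (\<eta> * p) * r) = exp (- \<alpha> * r / \<eta>) * a * exp (1 / q)"
    proof -
      have "- 1 / (\<eta> * p) * r = - (r / p / \<eta>)"
        by simp
      also have "\<dots> = - \<alpha> * r / \<eta> + - 1 / \<eta> + 1 / q"
        unfolding e1 e2 by simp
      finally show ?thesis
        by (simp only: exp_add a_def)
    qed
    have "(a powr \<alpha> / 2) powr r = exp (- \<alpha> * r / \<eta>) / 2 powr r"
      by (simp add: a_def powr_divide powr_powr exp_powr_real)
    then have lhs: "\<eta> powr \<theta>\<^sub>2 * ((a powr \<alpha> / 2) powr r * (a / 2))
      = (exp (- \<alpha> * r / \<eta>) * a) * (\<eta> powr \<theta>\<^sub>2 / (2 * 2 powr r))"
      by (simp add: mult_ac)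
    have "(c * C * X) powr r = (c * C) powr r * (exp (- 1 / (\<eta> * p) * r) * \<eta> powr (\<theta>\<^sub>1 / p * r))"
      by (simp only: X_def powr_mult powr_powr exp_powr_real)
    then have rhs: "(c * C * X) powr r
      = (exp (- \<alpha> * r / \<eta>) * a) * ((c * C) powr r * exp (1 / q) * \<eta> powr (\<theta>\<^sub>1 / p * r))"
      unfolding aX by (simp only: mult_ac)
    have "\<eta> powr \<theta>\<^sub>2 / (2 * 2 powr r) \<le> (c * C) powr r * exp (1 / q) * \<eta> powr (\<theta>\<^sub>1 / p * r)"
      using main a unfolding lhs rhs by (subst (asm) mult_le_cancel_left_pos) auto
    then have "\<eta> powr \<theta>\<^sub>2 / \<eta> powr (\<theta>\<^sub>1 / p * r) \<le> 2 * exp (1 / q) * (2 powr r * (c * C) powr r)"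
      using \<eta> by (simp add: field_simps)
    also have "2 powr r * (c * C) powr r = (2 * c * C) powr r"
      by (simp only: powr_mult mult.assoc)
    also have "(2 * c * C) powr r \<le> max 1 (2 * c * C) powr r"
      using r c by (intro powr_mono2) (auto simp: C_def)
    also have "\<dots> \<le> max 1 (2 * c * C) powr q"
      using r by (intro powr_mono) auto
    finally have "\<eta> powr (\<theta>\<^sub>2 - \<theta>\<^sub>1 / p * r) \<le> K"
      by (simp add: K_def powr_diff)
    moreover have "\<eta> powr (- (g / 2)) \<le> \<eta> powr (\<theta>\<^sub>2 - \<theta>\<^sub>1 / p * r)"
    proof (rule powr_mono')
      have exponent: "\<theta>\<^sub>2 - \<theta>\<^sub>1 / p * r = \<theta>\<^sub>1 / p * \<eta> - g"
        by (simp add: r_def g_def right_diff_distrib)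
      have "\<theta>\<^sub>1 / p * \<eta> \<le> \<theta>\<^sub>1 / p * (g * p / (2 * \<theta>\<^sub>1))"
        using \<theta> p \<eta> by (intro mult_left_mono) auto
      also have "\<dots> = g / 2"
        using \<theta> p by simp
      finally show "\<theta>\<^sub>2 - \<theta>\<^sub>1 / p * r \<le> - (g / 2)"
        unfolding exponent using g_def by linarith
    qed (use \<eta> in auto)
    ultimately show ?thesis
      by linarith
  qed
  \<comment> \<open>The last entry of the minimum makes \<open>\<eta> powr (- (g / 2))\<close> at least \<open>K + 1\<close>.\<close>
  define \<eta> where "\<eta> = min (min 1 ((q - 1) / 2)) (min (g * p / (2 * \<theta>\<^sub>1)) ((K + 1) powr (- (2 / g))))"
  have \<eta>0: "0 < \<eta>"
    using q1 g p \<theta> K by (simp add: \<eta>_def)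
  have "K + 1 = ((K + 1) powr (- (2 / g))) powr (- (g / 2))"
    using K g by (simp add: powr_powr)
  also have "\<dots> \<le> \<eta> powr (- (g / 2))"
    using \<eta>0 g by (intro powr_mono2') (auto simp: \<eta>_def)
  also have "\<dots> \<le> K"
  proof (rule small)
    have "\<eta> \<le> (q - 1) / 2"
      unfolding \<eta>_def by linarith
    also have "\<dots> < q - 1"
      using q1 by simp
    finally show "\<eta> < q - 1" .
  qed (use \<eta>0 in \<open>auto simp: \<eta>_def\<close>)
  finally show False
    by simp
qed

section \<open>The threshold theorem\<close>

lemma grand_bounded_cong:
  assumes "\<And>f x. x \<in> {0..1} \<Longrightarrow> T f x = U f x"
  shows "grand_bounded T p \<theta>\<^sub>1 q \<theta>\<^sub>2 \<longleftrightarrow> grand_bounded U p \<theta>\<^sub>1 q \<theta>\<^sub>2"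
proof -
  have "grand_norm q \<theta>\<^sub>2 (T f) = grand_norm q \<theta>\<^sub>2 (U f)"
    "T f \<in> grand_space q \<theta>\<^sub>2 \<longleftrightarrow> U f \<in> grand_space q \<theta>\<^sub>2" for f
    using grand_space_cong[of "T f" "U f"] assms by auto
  then show ?thesis
    by (simp add: grand_bounded_def)
qed

theorem corollary5p1:
  fixes p q \<alpha> \<theta>\<^sub>1 \<theta>\<^sub>2 :: real
    and T :: "(real \<Rightarrow> real) \<Rightarrow> (real \<Rightarrow> real)"
  assumes "1 < p" and "0 < \<alpha>" and "\<alpha> < 1 / p"
    and "q = p / (1 - \<alpha> * p)"
    and "0 < \<theta>\<^sub>1" and "0 < \<theta>\<^sub>2"
    and "T \<in> {I_op \<alpha>, R_op \<alpha>, W_op \<alpha>}"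
  shows "(\<theta>\<^sub>2 < (1 + \<alpha> * q) * \<theta>\<^sub>1 \<longrightarrow> \<not> grand_bounded T p \<theta>\<^sub>1 q \<theta>\<^sub>2) \<and>
         (\<theta>\<^sub>2 \<ge> (1 + \<alpha> * q) * \<theta>\<^sub>1 \<longrightarrow> grand_bounded T p \<theta>\<^sub>1 q \<theta>\<^sub>2)"
proof -
  have \<alpha>p: "\<alpha> * p < 1"
    using assms(1,3) by (simp add: field_simps)
  have "\<exists>S\<in>sets borel. (\<forall>f. \<forall>x\<in>{0..1}. T f x = kernel_op S \<alpha> f x) \<and>
      (\<forall>a>0. \<exists>l\<in>{0, a / 2}. \<exists>m\<in>{0, a / 2}. {l..l + a / 2} \<times> {m..m + a / 2} \<subseteq> S)"
    using assms(7)
  proof (elim insertE emptyE)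
    assume T: "T = I_op \<alpha>"
    show ?thesis
      by (rule bexI[of _ UNIV]) (auto simp: T I_op_eq_kernel_op)
  next
    assume T: "T = R_op \<alpha>"
    have "closed {(x, y). y \<le> (x::real)}"
      by (simp add: closed_Collect_le case_prod_unfold continuous_intros)
    then show ?thesis
      by (intro bexI[of _ "{(x, y). y \<le> x}"] conjI) (auto simp: T R_op_eq_kernel_op)
  next
    assume T: "T = W_op \<alpha>"
    have "closed {(x, y). (x::real) \<le> y}"
      by (simp add: closed_Collect_le case_prod_unfold continuous_intros)
    then show ?thesis
      by (intro bexI[of _ "{(x, y). x \<le> y}"] conjI) (auto simp: T W_op_eq_kernel_op)
  qed
  then obtain S where S: "S \<in> sets borel" and T: "\<And>f x. x \<in> {0..1} \<Longrightarrow> T f x = kernel_op S \<alpha> f x"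
    and box: "\<And>a. 0 < a \<Longrightarrow> \<exists>l\<in>{0, a / 2}. \<exists>m\<in>{0, a / 2}. {l..l + a / 2} \<times> {m..m + a / 2} \<subseteq> S"
    by blast
  have "grand_bounded T p \<theta>\<^sub>1 q \<theta>\<^sub>2 \<longleftrightarrow> grand_bounded (kernel_op S \<alpha>) p \<theta>\<^sub>1 q \<theta>\<^sub>2"
    by (rule grand_bounded_cong) (rule T)
  then show ?thesis
    using grand_bounded_kernel_op[OF assms(1,2) \<alpha>p assms(4,5) _ S]
      not_grand_bounded_kernel_op[OF assms(1,2) \<alpha>p assms(4,5) _ S box]
    by auto
qed

end
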